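(* Let $p$ and $q$ be distinct primes with $pq\neq 6$ and $q^{2}\mid p+1$. Let $D\in GF(p)$ be a non-square, let $\sigma$ be a primitive root (generator of the multiplicative group) of $GF(p^{2})=GF(p)(\sqrt{D})$, and let $m,n\in GF(p)$ be given by $m+n\sqrt{D}=\sigma^{\frac{p^{2}-1}{q^{2}}}$; assume $n\neq 0$. Let $G=\langle a,b,c\mid a^{q^{2}}=b^{p}=c^{p}=[b,c]=1,\ a^{-1}ba=b^{m}c^{nD},\ a^{-1}ca=b^{n}c^{m}\rangle$. Then $\mathrm{Aut}(G)\simeq(\mathbb{Z}_{p}\times\mathbb{Z}_{p})\rtimes(\mathbb{Z}_{p^{2}-1}\rtimes\mathbb{Z}_{2})$.
   Context: $\mathbb{Z}_n$ is the cyclic group of order $n$; $GF(p^k)$ is the field with $p^k$ elements; $[x,y]=x^{-1}y^{-1}xy$. Exponents of $b,c$ lying in $GF(p)$ are interpreted via integer representatives. $X\rtimes Y$ denotes a semidirect product with normal subgroup $X$ with respect to some homomorphism $Y\to\mathrm{Aut}(X)$; the statement asserts that $\mathrm{Aut}(G)$ is isomorphic to such an (iterated) semidirect product for some choice of actions. *)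

theory Defs
  imports "HOL-Algebra.Bij" "HOL-Algebra.Elementary_Groups" "HOL-Number_Theory.Residues"
begin

section \<open>Free groups and presentations\<close>

text \<open>A letter is a generator together with a sign: \<^term>\<open>(x, True)\<close> stands for \<^term>\<open>x\<close> and
  \<^term>\<open>(x, False)\<close> for its formal inverse.  The free group on the type of generators consists of
  the classes of words modulo insertion and deletion of cancelling pairs.\<close>

type_synonym 'x signed_word = "('x \<times> bool) list"

inductive free_equiv :: "'x signed_word \<Rightarrow> 'x signed_word \<Rightarrow> bool" where
  cancel: "free_equiv (u @ [(x, e), (x, \<not> e)] @ v) (u @ v)"
| refl: "free_equiv u u"
| sym: "free_equiv u v \<Longrightarrow> free_equiv v u"
| trans: "free_equiv u v \<Longrightarrow> free_equiv v w \<Longrightarrow> free_equiv u w"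

definition word_class :: "'x signed_word \<Rightarrow> 'x signed_word set"
  where "word_class u = {v. free_equiv u v}"

definition free_group :: "'x signed_word set monoid"
  where "free_group =
    \<lparr>carrier = range word_class,
     monoid.mult = \<lambda>U V. {w. \<exists>u\<in>U. \<exists>v\<in>V. free_equiv (u @ v) w},
     one = word_class []\<rparr>"

definition free_gen :: "'x \<Rightarrow> 'x signed_word set"
  where "free_gen x = word_class [(x, True)]"

definition normal_closure :: "('a, 'b) monoid_scheme \<Rightarrow> 'a set \<Rightarrow> 'a set"
  where "normal_closure G R =
    generate G {g \<otimes>\<^bsub>G\<^esub> r \<otimes>\<^bsub>G\<^esub> inv\<^bsub>G\<^esub> g | g r. g \<in> carrier G \<and> r \<in> R}"

text \<open>A pair \<^term>\<open>(u, v)\<close> in \<^term>\<open>E\<close> is the defining relation \<open>u = v\<close>.\<close>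

definition presented_group ::
    "('x signed_word set \<times> 'x signed_word set) set \<Rightarrow> 'x signed_word set set monoid"
  where "presented_group E =
    free_group Mod normal_closure free_group
      {u \<otimes>\<^bsub>free_group\<^esub> inv\<^bsub>free_group\<^esub> v | u v. (u, v) \<in> E}"

lemma free_equiv_append:
  assumes "free_equiv u u'" "free_equiv v v'"
  shows "free_equiv (u @ v) (u' @ v')"
proof -
  have "free_equiv (u @ w) (u' @ w)" for w
    using assms(1)
  proof (induction rule: free_equiv.induct)
    case (cancel u x e v)
    show ?case using free_equiv.cancel[of u x e "v @ w"] by simp
  qed (auto intro: free_equiv.intros)
  moreover have "free_equiv (w @ v) (w @ v')" for w
    using assms(2)
  proof (induction rule: free_equiv.induct)
    case (cancel u x e v)
    show ?case using free_equiv.cancel[of "w @ u" x e v] by simp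
  qed (auto intro: free_equiv.intros)
  ultimately show ?thesis by (blast intro: free_equiv.trans)
qed

lemma word_class_eq_iff: "word_class u = word_class v \<longleftrightarrow> free_equiv u v"
  unfolding word_class_def by (blast intro: free_equiv.intros)

lemma free_group_mult:
  "word_class u \<otimes>\<^bsub>free_group\<^esub> word_class v = word_class (u @ v)"
  unfolding free_group_def word_class_def
  by (auto intro: free_equiv.intros free_equiv_append)

definition inverse_word :: "'x signed_word \<Rightarrow> 'x signed_word"
  where "inverse_word u = rev (map (\<lambda>(x, e). (x, \<not> e)) u)"

lemma inverse_word_append: "free_equiv (inverse_word u @ u) []"
proof (induction u)
  case (Cons l u)
  obtain x e where l: "l = (x, e)" by (cases l)
  have "free_equiv (inverse_word (l # u) @ l # u) (inverse_word u @ u)"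
    using free_equiv.cancel[of "inverse_word u" x "\<not> e" u] by (simp add: l inverse_word_def)
  with Cons show ?case by (blast intro: free_equiv.trans)
qed (simp add: inverse_word_def free_equiv.refl)

lemma group_free_group: "group (free_group :: 'x signed_word set monoid)"
proof (rule groupI)
  let ?F = "free_group :: 'x signed_word set monoid"
  have car: "carrier ?F = range word_class" and one: "\<one>\<^bsub>?F\<^esub> = word_class []"
    by (simp_all add: free_group_def)
  show "\<one>\<^bsub>?F\<^esub> \<in> carrier ?F" by (simp add: car one)
  show "x \<otimes>\<^bsub>?F\<^esub> y \<in> carrier ?F" if "x \<in> carrier ?F" "y \<in> carrier ?F" for x y
    using that by (auto simp: car free_group_mult)
  show "x \<otimes>\<^bsub>?F\<^esub> y \<otimes>\<^bsub>?F\<^esub> z = x \<otimes>\<^bsub>?F\<^esub> (y \<otimes>\<^bsub>?F\<^esub> z)"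
    if "x \<in> carrier ?F" "y \<in> carrier ?F" "z \<in> carrier ?F" for x y z
    using that by (auto simp: car free_group_mult)
  show "\<one>\<^bsub>?F\<^esub> \<otimes>\<^bsub>?F\<^esub> x = x" if "x \<in> carrier ?F" for x
    using that by (auto simp: car one free_group_mult)
  show "\<exists>y\<in>carrier ?F. y \<otimes>\<^bsub>?F\<^esub> x = \<one>\<^bsub>?F\<^esub>" if x: "x \<in> carrier ?F" for x
  proof -
    obtain u where "x = word_class u" using x by (auto simp: car)
    then have "word_class (inverse_word u) \<otimes>\<^bsub>?F\<^esub> x = \<one>\<^bsub>?F\<^esub>"
      by (simp add: free_group_mult one word_class_eq_iff inverse_word_append)
    then show ?thesis by (auto simp: car)
  qed
qed

lemma (in group) normal_normal_closure:
  assumes "R \<subseteq> carrier G"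
  shows "normal_closure G R \<lhd> G"
  unfolding normal_closure_def
proof (rule normal_generateI)
  show "{g \<otimes> r \<otimes> inv g | g r. g \<in> carrier G \<and> r \<in> R} \<subseteq> carrier G"
    using assms by auto
next
  fix h g assume "h \<in> {g \<otimes> r \<otimes> inv g | g r. g \<in> carrier G \<and> r \<in> R}" and g: "g \<in> carrier G"
  then obtain k r where k: "k \<in> carrier G" "r \<in> R" "h = k \<otimes> r \<otimes> inv k" by blast
  with assms have "r \<in> carrier G" by blast
  with k g have "g \<otimes> h \<otimes> inv g = (g \<otimes> k) \<otimes> r \<otimes> inv (g \<otimes> k)"
    by (simp add: m_assoc inv_mult_group)
  with k g show "g \<otimes> h \<otimes> inv g \<in> {g \<otimes> r \<otimes> inv g | g r. g \<in> carrier G \<and> r \<in> R}"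
    by blast
qed

section \<open>Semidirect products\<close>

definition semidirect ::
    "('a, 'c) monoid_scheme \<Rightarrow> ('b, 'd) monoid_scheme \<Rightarrow> ('b \<Rightarrow> 'a \<Rightarrow> 'a) \<Rightarrow> ('a \<times> 'b) monoid"
  where "semidirect N H \<theta> =
    \<lparr>carrier = carrier N \<times> carrier H,
     monoid.mult = \<lambda>(x, y) (x', y'). (x \<otimes>\<^bsub>N\<^esub> \<theta> y x', y \<otimes>\<^bsub>H\<^esub> y'),
     one = (\<one>\<^bsub>N\<^esub>, \<one>\<^bsub>H\<^esub>)\<rparr>"

lemma group_semidirect:
  assumes "group N" "group H" and \<theta>: "\<theta> \<in> hom H (AutoGroup N)"
  shows "group (semidirect N H \<theta>)"
proof -
  interpret N: group N by fact
  interpret H: group H by fact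
  interpret A: group "AutoGroup N" by (rule N.AutoGroup)
  interpret \<theta>: group_hom H "AutoGroup N" \<theta>
    using \<theta> by unfold_locales
  have aut: "\<theta> y \<in> hom N N" "\<theta> y \<in> Bij (carrier N)" if "y \<in> carrier H" for y
    using \<theta>.hom_closed[OF that] by (auto simp: AutoGroup_def auto_def)
  have cl: "\<theta> y x \<in> carrier N" if "y \<in> carrier H" "x \<in> carrier N" for x y
    using aut that by (auto simp: hom_def)
  have hm: "\<theta> y (x \<otimes>\<^bsub>N\<^esub> x') = \<theta> y x \<otimes>\<^bsub>N\<^esub> \<theta> y x'"
    if "y \<in> carrier H" "x \<in> carrier N" "x' \<in> carrier N" for y x x'
    using aut that by (auto simp: hom_def)
  have comp: "\<theta> (y \<otimes>\<^bsub>H\<^esub> y') x = \<theta> y (\<theta> y' x)"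
    if "y \<in> carrier H" "y' \<in> carrier H" "x \<in> carrier N" for y y' x
    using \<theta>.hom_mult[OF that(1,2)] aut that
    by (simp add: AutoGroup_def BijGroup_def compose_def)
  have id: "\<theta> \<one>\<^bsub>H\<^esub> x = x" if "x \<in> carrier N" for x
    using \<theta>.hom_one that by (simp add: AutoGroup_def BijGroup_def)
  show ?thesis
  proof (rule groupI, goal_cases)
    case (5 z)
    then obtain x y where z: "z = (x, y)" "x \<in> carrier N" "y \<in> carrier H"
      by (auto simp: semidirect_def)
    let ?w = "(\<theta> (inv\<^bsub>H\<^esub> y) (inv\<^bsub>N\<^esub> x), inv\<^bsub>H\<^esub> y)"
    have "?w \<otimes>\<^bsub>semidirect N H \<theta>\<^esub> z = \<one>\<^bsub>semidirect N H \<theta>\<^esub>"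
    proof -
      have "\<theta> (inv\<^bsub>H\<^esub> y) (inv\<^bsub>N\<^esub> x) \<otimes>\<^bsub>N\<^esub> \<theta> (inv\<^bsub>H\<^esub> y) x = \<theta> (inv\<^bsub>H\<^esub> y) \<one>\<^bsub>N\<^esub>"
        using z hm[of "inv\<^bsub>H\<^esub> y" "inv\<^bsub>N\<^esub> x" x] by simp
      also have "\<dots> = \<one>\<^bsub>N\<^esub>"
        using z aut(1)[of "inv\<^bsub>H\<^esub> y"] by (simp add: hom_one N.is_group)
      finally show ?thesis using z by (simp add: semidirect_def del: \<theta>.hom_inv)
    qed
    moreover have "?w \<in> carrier (semidirect N H \<theta>)"
      using z cl by (simp add: semidirect_def del: \<theta>.hom_inv)
    ultimately show ?case by blast
  qed (auto simp: semidirect_def cl hm comp id N.m_assoc H.m_assoc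
      simp del: \<theta>.hom_mult \<theta>.hom_one)
qed

section \<open>The group under consideration\<close>

datatype abc = GenA | GenB | GenC

definition G_group :: "nat \<Rightarrow> nat \<Rightarrow> int \<Rightarrow> int \<Rightarrow> int \<Rightarrow> abc signed_word set set monoid"
  where "G_group p q D m n =
    (let F = free_group; a = free_gen GenA; b = free_gen GenB; c = free_gen GenC
     in presented_group
      {(a [^]\<^bsub>F\<^esub> q\<^sup>2, \<one>\<^bsub>F\<^esub>),
       (b [^]\<^bsub>F\<^esub> p, \<one>\<^bsub>F\<^esub>),
       (c [^]\<^bsub>F\<^esub> p, \<one>\<^bsub>F\<^esub>),
       (inv\<^bsub>F\<^esub> b \<otimes>\<^bsub>F\<^esub> inv\<^bsub>F\<^esub> c \<otimes>\<^bsub>F\<^esub> b \<otimes>\<^bsub>F\<^esub> c, \<one>\<^bsub>F\<^esub>),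
       (inv\<^bsub>F\<^esub> a \<otimes>\<^bsub>F\<^esub> b \<otimes>\<^bsub>F\<^esub> a, b [^]\<^bsub>F\<^esub> m \<otimes>\<^bsub>F\<^esub> c [^]\<^bsub>F\<^esub> (n * D)),
       (inv\<^bsub>F\<^esub> a \<otimes>\<^bsub>F\<^esub> c \<otimes>\<^bsub>F\<^esub> a, b [^]\<^bsub>F\<^esub> n \<otimes>\<^bsub>F\<^esub> c [^]\<^bsub>F\<^esub> m)})"

end

theory Submission
  imports Defs
begin

text \<open>The letters \<open>b\<close> and \<open>c\<close> stand for the translations by \<open>s\<close> and by
  \<open>1\<close> of the field \<open>K\<close>, and the two conjugation relations say that \<open>a\<^sup>-\<^sup>1\<close> acts on them
  as multiplication by \<open>\<alpha> = m + n s\<close>, an element of order \<open>N = q\<^sup>2\<close>.  So the presented group is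
  the group \<open>M\<close> of affine maps \<open>x \<mapsto> u x + k\<close> of \<open>K\<close> with \<open>u\<^sup>N = 1\<close>.  The relations
  move every \<open>a\<close> to the right of a word, which leaves at most \<open>p\<^sup>2 N = |M|\<close> elements, and this
  makes the evident surjection onto \<open>M\<close> injective (\<open>presented_group_iso\<close>).

  The automorphisms of \<open>M\<close> are exactly the conjugations by the maps
  \<open>x \<mapsto> \<mu> x\<^sup>F + t\<close> with \<open>\<mu> \<noteq> 0\<close> and \<open>F\<close> either the identity or the Galois
  conjugation of \<open>K\<close> (\<open>phi_auto\<close>, \<open>auto_is_phi\<close>).  The reason is that an automorphism preserves
  the translations, which are the elements of order dividing \<open>p\<close>, and acts on them by an additive
  map \<open>T\<close> with \<open>T (\<alpha> k) = \<beta> T k\<close>.  Such a \<open>T\<close> is linear over the prime field, hence \<open>\<beta>\<close> is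
  a root of the quadratic equation of \<open>\<alpha>\<close> over the prime field, so \<open>\<beta>\<close> is \<open>\<alpha>\<close> or its
  conjugate, and \<open>T k = T 1 k\<close> or \<open>T k = T 1 k\<^sup>F\<close> because \<open>1\<close> and \<open>\<alpha>\<close> span \<open>K\<close>.  The
  value at the rotation \<open>\<alpha>\<close> is then adjusted by \<open>t\<close>, since \<open>1 - \<beta>\<close> is invertible.

  Composing these maps, the translations by \<open>t\<close> form a normal subgroup \<open>Z\<^sub>p \<times> Z\<^sub>p\<close>, the
  factors \<open>\<mu>\<close> form the cyclic group of \<open>K\<close>, and \<open>F\<close> has order two.  Two applications of the
  internal characterisation of semidirect products (\<open>semidirect_recognition\<close>) give the result.\<close>

section \<open>Automorphism groups and internal semidirect products\<close>

lemma carrier_AutoGroup_iff: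
  "f \<in> carrier (AutoGroup G) \<longleftrightarrow>
    f \<in> hom G G \<and> bij_betw f (carrier G) (carrier G) \<and> f \<in> extensional (carrier G)"
  by (auto simp: AutoGroup_def auto_def Bij_def)

lemma mult_AutoGroup:
  assumes "f \<in> carrier (AutoGroup G)" "g \<in> carrier (AutoGroup G)"
  shows "f \<otimes>\<^bsub>AutoGroup G\<^esub> g = compose (carrier G) f g"
  using assms by (simp add: AutoGroup_def BijGroup_def auto_def)

lemma one_AutoGroup: "\<one>\<^bsub>AutoGroup G\<^esub> = (\<lambda>x\<in>carrier G. x)"
  by (simp add: AutoGroup_def BijGroup_def)

lemma transport_auto:
  assumes "group G" "group H" and hk: "group_isomorphisms G H h k" and f: "f \<in> carrier (AutoGroup G)"
  shows "(\<lambda>y\<in>carrier H. h (f (k y))) \<in> carrier (AutoGroup H)"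
proof -
  have hom: "h \<in> hom G H" "k \<in> hom H G"
    and inv: "\<And>x. x \<in> carrier G \<Longrightarrow> k (h x) = x" "\<And>y. y \<in> carrier H \<Longrightarrow> h (k y) = y"
    using hk by (auto simp: group_isomorphisms_def)
  have f': "f \<in> hom G G" "bij_betw f (carrier G) (carrier G)"
    using f by (auto simp: carrier_AutoGroup_iff)
  have "bij_betw k (carrier H) (carrier G)" "bij_betw h (carrier G) (carrier H)"
    using hom inv by (auto intro!: bij_betw_byWitness[where f' = h] bij_betw_byWitness[where f' = k] simp: hom_def)
  then have "bij_betw (h \<circ> (f \<circ> k)) (carrier H) (carrier H)"
    using f'(2) by (blast intro: bij_betw_trans)
  then have "bij_betw (\<lambda>y\<in>carrier H. h (f (k y))) (carrier H) (carrier H)"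
    by (rule bij_betw_cong[THEN iffD1, rotated]) simp
  moreover have "(\<lambda>y\<in>carrier H. h (f (k y))) \<in> hom H H"
    using hom f'(1) group.is_monoid[OF \<open>group H\<close>] by (auto simp: hom_def Pi_iff monoid.m_closed)
  ultimately show ?thesis by (simp add: carrier_AutoGroup_iff)
qed

lemma AutoGroup_iso_cong:
  assumes "group G" "group H" "G \<cong> H"
  shows "AutoGroup G \<cong> AutoGroup H"
proof -
  obtain h where "h \<in> iso G H" using assms(3) by (auto simp: is_iso_def)
  then obtain k where hk: "group_isomorphisms G H h k"
    using assms(1) by (metis group.iso_iff_group_isomorphisms)
  then have kh: "group_isomorphisms H G k h"
    by (auto simp: group_isomorphisms_def)
  note inv = hk[unfolded group_isomorphisms_def]
  let ?F = "\<lambda>f. \<lambda>y\<in>carrier H. h (f (k y))" and ?B = "\<lambda>f. \<lambda>y\<in>carrier G. k (f (h y))"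
  have "?F \<in> iso (AutoGroup G) (AutoGroup H)"
  proof (rule isoI)
    show "?F \<in> hom (AutoGroup G) (AutoGroup H)"
    proof (rule homI)
      fix f g assume f: "f \<in> carrier (AutoGroup G)" and g: "g \<in> carrier (AutoGroup G)"
      then have "f \<in> carrier G \<rightarrow> carrier G" "g \<in> carrier G \<rightarrow> carrier G"
        by (auto simp: carrier_AutoGroup_iff hom_def)
      with inv show "?F (f \<otimes>\<^bsub>AutoGroup G\<^esub> g) = ?F f \<otimes>\<^bsub>AutoGroup H\<^esub> ?F g"
        unfolding mult_AutoGroup[OF f g]
          mult_AutoGroup[OF transport_auto[OF assms(1,2) hk f] transport_auto[OF assms(1,2) hk g]]
        by (auto simp: compose_def hom_def Pi_iff restrict_def fun_eq_iff)
    qed (rule transport_auto[OF assms(1,2) hk])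
    show "bij_betw ?F (carrier (AutoGroup G)) (carrier (AutoGroup H))"
    proof (rule bij_betw_byWitness[where f' = ?B])
      show "\<forall>f\<in>carrier (AutoGroup G). ?B (?F f) = f"
      proof
        fix f assume "f \<in> carrier (AutoGroup G)"
        then have "f \<in> carrier G \<rightarrow> carrier G" "f \<in> extensional (carrier G)"
          by (auto simp: carrier_AutoGroup_iff hom_def)
        then show "?B (?F f) = f"
          using inv by (auto simp: fun_eq_iff extensional_def hom_def Pi_iff)
      qed
      show "\<forall>f\<in>carrier (AutoGroup H). ?F (?B f) = f"
      proof
        fix f assume "f \<in> carrier (AutoGroup H)"
        then have "f \<in> carrier H \<rightarrow> carrier H" "f \<in> extensional (carrier H)"
          by (auto simp: carrier_AutoGroup_iff hom_def)
        then show "?F (?B f) = f"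
          using inv by (auto simp: fun_eq_iff extensional_def hom_def Pi_iff)
      qed
      show "?F ` carrier (AutoGroup G) \<subseteq> carrier (AutoGroup H)"
        using transport_auto[OF assms(1,2) hk] by blast
      show "?B ` carrier (AutoGroup H) \<subseteq> carrier (AutoGroup G)"
        using transport_auto[OF assms(2,1) kh] by blast
    qed
  qed
  then show ?thesis by (rule is_isoI)
qed

text \<open>An internal semidirect product: with \<open>f\<close> and \<open>g\<close> embedding \<open>N\<close> and \<open>H\<close> into
  \<open>A\<close>, the action of \<open>y\<close> on \<open>N\<close> is conjugation by \<open>g y\<close>, pulled back along \<open>f\<close>.  The
  element \<open>x'\<close> of the normality hypothesis is the image of \<open>x\<close> under this action; it is unique because
  \<open>f\<close> is injective.\<close>

lemma semidirect_recognition: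
  assumes "group A" "group N" "group H"
    and f: "f \<in> hom N A" "inj_on f (carrier N)"
    and g: "g \<in> hom H A" "inj_on g (carrier H)"
    and norm: "\<And>x y. x \<in> carrier N \<Longrightarrow> y \<in> carrier H \<Longrightarrow>
      \<exists>x'\<in>carrier N. g y \<otimes>\<^bsub>A\<^esub> f x = f x' \<otimes>\<^bsub>A\<^esub> g y"
    and triv: "\<And>x y. x \<in> carrier N \<Longrightarrow> y \<in> carrier H \<Longrightarrow> f x = g y \<Longrightarrow> x = \<one>\<^bsub>N\<^esub>"
    and sur: "\<And>z. z \<in> carrier A \<Longrightarrow> \<exists>x\<in>carrier N. \<exists>y\<in>carrier H. z = f x \<otimes>\<^bsub>A\<^esub> g y"
  obtains \<theta> where "\<theta> \<in> hom H (AutoGroup N)"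
    and "(\<lambda>(x, y). f x \<otimes>\<^bsub>A\<^esub> g y) \<in> iso (semidirect N H \<theta>) A"
proof -
  interpret A: group A by fact
  interpret N: group N by fact
  interpret H: group H by fact
  interpret f: group_hom N A f using f by unfold_locales
  interpret g: group_hom H A g using g by unfold_locales
  have f_eq: "f x = f x' \<longleftrightarrow> x = x'" if "x \<in> carrier N" "x' \<in> carrier N" for x x'
    using f(2) that by (auto simp: inj_on_def)
  from norm obtain r where r: "r x y \<in> carrier N" "g y \<otimes>\<^bsub>A\<^esub> f x = f (r x y) \<otimes>\<^bsub>A\<^esub> g y"
    if "x \<in> carrier N" "y \<in> carrier H" for x y by metis
  define \<theta> where "\<theta> y = (\<lambda>x\<in>carrier N. r x y)" for y
  have cl: "\<theta> y x \<in> carrier N" if "x \<in> carrier N" "y \<in> carrier H" for x y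
    using that r by (simp add: \<theta>_def)
  have eq: "f (\<theta> y x) = g y \<otimes>\<^bsub>A\<^esub> f x \<otimes>\<^bsub>A\<^esub> inv\<^bsub>A\<^esub> g y" if "x \<in> carrier N" "y \<in> carrier H" for x y
    using that r[OF that] by (simp add: \<theta>_def A.inv_solve_right)
  have hm: "\<theta> y (x \<otimes>\<^bsub>N\<^esub> x') = \<theta> y x \<otimes>\<^bsub>N\<^esub> \<theta> y x'"
    if "x \<in> carrier N" "x' \<in> carrier N" "y \<in> carrier H" for x x' y
  proof -
    have "f (\<theta> y (x \<otimes>\<^bsub>N\<^esub> x')) = f (\<theta> y x) \<otimes>\<^bsub>A\<^esub> f (\<theta> y x')"
      using that by (simp add: eq A.m_assoc A.inv_solve_left A.inv_solve_left')
    then show ?thesis using that cl by (simp flip: f.hom_mult add: f_eq)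
  qed
  have comp: "\<theta> (y \<otimes>\<^bsub>H\<^esub> y') x = \<theta> y (\<theta> y' x)"
    if "x \<in> carrier N" "y \<in> carrier H" "y' \<in> carrier H" for x y y'
  proof -
    have "f (\<theta> (y \<otimes>\<^bsub>H\<^esub> y') x) = f (\<theta> y (\<theta> y' x))"
      using that cl by (simp add: eq A.m_assoc A.inv_mult_group)
    then show ?thesis using that cl by (simp add: f_eq)
  qed
  have one: "\<theta> \<one>\<^bsub>H\<^esub> x = x" if "x \<in> carrier N" for x
  proof -
    have "f (\<theta> \<one>\<^bsub>H\<^esub> x) = f x" using that by (simp add: eq)
    then show ?thesis using that cl by (simp add: f_eq)
  qed
  have aut: "\<theta> y \<in> carrier (AutoGroup N)" if y: "y \<in> carrier H" for y
  proof -
    have "bij_betw (\<theta> y) (carrier N) (carrier N)"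
      using y cl by (intro bij_betw_byWitness[where f' = "\<theta> (inv\<^bsub>H\<^esub> y)"])
        (auto simp flip: comp simp: one)
    moreover have "\<theta> y \<in> hom N N" using y cl hm by (auto simp: hom_def)
    ultimately show ?thesis by (simp add: carrier_AutoGroup_iff \<theta>_def)
  qed
  have hom: "\<theta> \<in> hom H (AutoGroup N)"
  proof (rule homI)
    fix y y' assume y: "y \<in> carrier H" "y' \<in> carrier H"
    show "\<theta> (y \<otimes>\<^bsub>H\<^esub> y') = \<theta> y \<otimes>\<^bsub>AutoGroup N\<^esub> \<theta> y'"
      unfolding mult_AutoGroup[OF aut[OF y(1)] aut[OF y(2)]]
      using y comp by (auto simp: compose_def \<theta>_def fun_eq_iff restrict_def)
  qed (rule aut)
  have "(\<lambda>(x, y). f x \<otimes>\<^bsub>A\<^esub> g y) \<in> iso (semidirect N H \<theta>) A"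
  proof (rule isoI)
    show "(\<lambda>(x, y). f x \<otimes>\<^bsub>A\<^esub> g y) \<in> hom (semidirect N H \<theta>) A"
    proof (rule homI; clarify)
      fix x y x' y' assume "(x, y) \<in> carrier (semidirect N H \<theta>)" "(x', y') \<in> carrier (semidirect N H \<theta>)"
      then have c: "x \<in> carrier N" "y \<in> carrier H" "x' \<in> carrier N" "y' \<in> carrier H"
        by (auto simp: semidirect_def)
      have "f (\<theta> y x') \<otimes>\<^bsub>A\<^esub> g y = g y \<otimes>\<^bsub>A\<^esub> f x'"
        using c r by (simp add: \<theta>_def)
      then have "f (\<theta> y x') \<otimes>\<^bsub>A\<^esub> (g y \<otimes>\<^bsub>A\<^esub> g y') = g y \<otimes>\<^bsub>A\<^esub> (f x' \<otimes>\<^bsub>A\<^esub> g y')"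
        using c cl by (simp flip: A.m_assoc)
      with c cl show "(case (x, y) \<otimes>\<^bsub>semidirect N H \<theta>\<^esub> (x', y') of (x, y) \<Rightarrow> f x \<otimes>\<^bsub>A\<^esub> g y)
          = f x \<otimes>\<^bsub>A\<^esub> g y \<otimes>\<^bsub>A\<^esub> (f x' \<otimes>\<^bsub>A\<^esub> g y')"
        by (simp add: semidirect_def A.m_assoc)
    qed (auto simp: semidirect_def)
    have "inj_on (\<lambda>(x, y). f x \<otimes>\<^bsub>A\<^esub> g y) (carrier N \<times> carrier H)"
    proof (rule inj_onI; clarify)
      fix x y x' y' assume c: "x \<in> carrier N" "y \<in> carrier H" "x' \<in> carrier N" "y' \<in> carrier H"
        and e: "f x \<otimes>\<^bsub>A\<^esub> g y = f x' \<otimes>\<^bsub>A\<^esub> g y'"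
      have "f (inv\<^bsub>N\<^esub> x' \<otimes>\<^bsub>N\<^esub> x) \<otimes>\<^bsub>A\<^esub> g y = g y'"
        using c e by (simp add: A.m_assoc A.inv_solve_left')
      then have "f (inv\<^bsub>N\<^esub> x' \<otimes>\<^bsub>N\<^esub> x) = g (y' \<otimes>\<^bsub>H\<^esub> inv\<^bsub>H\<^esub> y)"
        using c by (metis A.inv_solve_right H.inv_closed N.inv_closed N.m_closed f.hom_closed
            g.hom_closed g.hom_inv g.hom_mult)
      then have "inv\<^bsub>N\<^esub> x' \<otimes>\<^bsub>N\<^esub> x = \<one>\<^bsub>N\<^esub>"
        using c triv[of "inv\<^bsub>N\<^esub> x' \<otimes>\<^bsub>N\<^esub> x" "y' \<otimes>\<^bsub>H\<^esub> inv\<^bsub>H\<^esub> y"] by simp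
      then have x: "x = x'" using c by (metis N.inv_closed N.inv_equality N.inv_inv)
      with e c have "g y = g y'" by simp
      with x c g(2) show "x = x' \<and> y = y'" by (auto simp: inj_on_def)
    qed
    moreover have "(\<lambda>(x, y). f x \<otimes>\<^bsub>A\<^esub> g y) ` (carrier N \<times> carrier H) = carrier A"
      using sur by (force simp: image_def)
    ultimately show "bij_betw (\<lambda>(x, y). f x \<otimes>\<^bsub>A\<^esub> g y) (carrier (semidirect N H \<theta>)) (carrier A)"
      by (simp add: bij_betw_def semidirect_def)
  qed
  with hom show thesis by (rule that)
qed

section \<open>The field with \<open>p\<^sup>2\<close> elements in coordinates\<close>

text \<open>Everything about \<open>K\<close> is computed in the coordinates \<open>x + y s\<close> with integers \<open>x\<close> and
  \<open>y\<close> read modulo \<open>p\<close>.  This makes the Frobenius map explicit, as \<open>x + y s \<mapsto> x - y s\<close>, so that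
  no binomial expansion of \<open>p\<close>-th powers is needed.\<close>

locale quadratic_field = field K for K (structure) +
  fixes p :: nat and D :: int and s
  assumes prime_p: "prime p" and card_K: "card (carrier K) = p\<^sup>2"
    and s_closed [simp, intro]: "s \<in> carrier K"
    and s_square: "s \<otimes> s = add_pow K D \<one>"
    and D_nonsquare: "\<not> QuadRes (int p) D"
begin

definition emb :: "int \<Rightarrow> 'a" where "emb i = add_pow K i \<one>"

definition lin :: "int \<Rightarrow> int \<Rightarrow> 'a" where "lin x y = emb x \<oplus> emb y \<otimes> s"

lemma emb_closed [simp, intro]: "emb i \<in> carrier K"
  by (simp add: emb_def)

lemma lin_closed [simp, intro]: "lin x y \<in> carrier K"
  by (simp add: lin_def)

lemma emb_0 [simp]: "emb 0 = \<zero>" and emb_1 [simp]: "emb 1 = \<one>"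
  using add.int_pow_1[of \<one>] by (simp_all add: emb_def add_pow_def)

lemma emb_add: "emb (i + j) = emb i \<oplus> emb j"
  by (simp add: emb_def add.int_pow_mult)

lemma emb_minus: "emb (- i) = \<ominus> emb i"
  by (simp add: emb_def add.int_pow_neg)

lemma emb_mult: "emb (i * j) = emb i \<otimes> emb j"
proof -
  have "emb i \<otimes> emb j = [i] \<cdot> ([j] \<cdot> \<one>)"
    by (simp add: emb_def add_pow_ldistr_int)
  then show ?thesis
    by (simp add: emb_def add.int_pow_pow mult.commute)
qed

lemma add_pow_eq_emb: "x \<in> carrier K \<Longrightarrow> add_pow K (i::int) x = emb i \<otimes> x"
  by (simp add: emb_def add_pow_ldistr_int)

lemma finite_K: "finite (carrier K)"
  using card_K prime_p by (metis card.infinite not_prime_0 power_eq_0_iff zero_neq_numeral)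

text \<open>By Lagrange, \<open>p\<^sup>2 \<cdot> 1 = 0\<close>; a field has no zero divisors, so \<open>p \<cdot> 1 = 0\<close>.\<close>

lemma emb_p [simp]: "emb (int p) = \<zero>"
proof -
  have "[order (add_monoid K)] \<cdot> \<one> = \<zero>"
    using add.pow_order_eq_1[of \<one>] finite_K by simp
  then have "emb (int (p\<^sup>2)) = \<zero>"
    using card_K by (simp add: emb_def order_def add_pow_int_ge nat_power_eq)
  then have "emb (int p) \<otimes> emb (int p) = \<zero>"
    by (simp add: power2_eq_square flip: emb_mult)
  then show ?thesis by (simp add: integral_iff)
qed

lemma emb_eq_0_iff: "emb i = \<zero> \<longleftrightarrow> int p dvd i"
proof
  assume "int p dvd i"
  then show "emb i = \<zero>" by (auto simp: dvd_def emb_mult)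
next
  assume 0: "emb i = \<zero>"
  show "int p dvd i"
  proof (rule ccontr)
    assume "\<not> int p dvd i"
    then have "coprime (int p) i" using prime_p by (simp add: prime_imp_coprime)
    then obtain u v where "u * int p + v * i = 1"
      by (metis bezout_int coprime_iff_gcd_eq_1)
    then have "emb (u * int p + v * i) = \<one>" by simp
    with 0 show False by (simp add: emb_add emb_mult)
  qed
qed

lemma emb_eq_iff: "emb i = emb j \<longleftrightarrow> [i = j] (mod int p)"
proof -
  have "emb i = emb j \<longleftrightarrow> emb (i - j) = \<zero>"
    using emb_add[of i "- j"] by (simp add: emb_minus minus_eq[symmetric])
  then show ?thesis by (simp add: emb_eq_0_iff cong_iff_dvd_diff)
qed

lemma lin_add: "lin x y \<oplus> lin x' y' = lin (x + x') (y + y')"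
  unfolding lin_def emb_add by (simp add: l_distr a_ac)

lemma lin_minus: "\<ominus> lin x y = lin (- x) (- y)"
  unfolding lin_def emb_minus by (simp add: l_minus minus_add a_comm)

lemma lin_mult: "lin x y \<otimes> lin x' y' = lin (x * x' + y * y' * D) (x * y' + y * x')"
proof -
  have "lin x y \<otimes> lin x' y' = emb x \<otimes> emb x' \<oplus> emb y \<otimes> emb y' \<otimes> (s \<otimes> s)
      \<oplus> (emb x \<otimes> emb y' \<oplus> emb y \<otimes> emb x') \<otimes> s"
    unfolding lin_def using emb_closed[of x] emb_closed[of y] emb_closed[of x'] emb_closed[of y'] s_closed
    by algebra
  then show ?thesis unfolding s_square emb_def[symmetric] lin_def emb_add emb_mult by simp
qed

lemma lin_0_right: "lin x 0 = emb x" and lin_0_1: "lin 0 1 = s"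
  by (simp_all add: lin_def)

text \<open>If \<open>y\<close> were invertible modulo \<open>p\<close>, then \<open>s = - x / y\<close> would lie in the prime field and
  \<open>D\<close> would be a square.\<close>

lemma lin_eq_0_iff: "lin x y = \<zero> \<longleftrightarrow> int p dvd x \<and> int p dvd y"
proof
  assume 0: "lin x y = \<zero>"
  have "int p dvd y"
  proof (rule ccontr)
    assume "\<not> int p dvd y"
    then have "coprime (int p) y" using prime_p by (simp add: prime_imp_coprime)
    then obtain u v where uv: "u * int p + v * y = 1"
      by (metis bezout_int coprime_iff_gcd_eq_1)
    have "v * y = 1 - u * int p" using uv by simp
    then have "[v * y = 1] (mod int p)" by (simp add: cong_iff_dvd_diff)
    then have vy: "emb (v * y) = \<one>" using emb_eq_iff[of "v * y" 1] by simp
    have "emb v \<otimes> lin x y = emb (v * x) \<oplus> emb (v * y) \<otimes> s"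
      unfolding lin_def emb_mult by (simp add: r_distr m_assoc)
    with 0 vy have "emb (v * x) \<oplus> s = \<zero>" by simp
    then have "s = emb (- (v * x))"
      by (metis a_comm emb_closed emb_minus minus_equality s_closed)
    then have "emb D = emb (v * x * (v * x))"
      using s_square unfolding emb_def[symmetric] by (simp flip: emb_mult)
    then have "[(v * x)\<^sup>2 = D] (mod int p)"
      by (simp add: emb_eq_iff power2_eq_square cong_sym)
    then show False using D_nonsquare by (auto simp: QuadRes_def)
  qed
  moreover from this have "emb y = \<zero>" by (simp add: emb_eq_0_iff)
  with 0 have "emb x = \<zero>" by (simp add: lin_def)
  ultimately show "int p dvd x \<and> int p dvd y" by (simp add: emb_eq_0_iff)
next
  assume "int p dvd x \<and> int p dvd y"
  then have "emb x = \<zero>" "emb y = \<zero>" by (simp_all add: emb_eq_0_iff)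
  then show "lin x y = \<zero>" by (simp add: lin_def)
qed

lemma lin_eq_iff: "lin x y = lin x' y' \<longleftrightarrow> [x = x'] (mod int p) \<and> [y = y'] (mod int p)"
proof -
  have "lin x y = lin x' y' \<longleftrightarrow> lin x y \<oplus> lin (- x') (- y') = \<zero>"
    by (simp flip: lin_minus minus_eq)
  then show ?thesis by (simp add: lin_add lin_eq_0_iff cong_iff_dvd_diff)
qed

text \<open>Injectivity is uniqueness of coordinates; surjectivity follows by counting.\<close>

lemma lin_bij: "bij_betw (\<lambda>(x, y). lin x y) ({0..<int p} \<times> {0..<int p}) (carrier K)"
proof -
  have inj: "inj_on (\<lambda>(x, y). lin x y) ({0..<int p} \<times> {0..<int p})"
    by (auto simp: inj_on_def lin_eq_iff cong_def)
  moreover have "(\<lambda>(x, y). lin x y) ` ({0..<int p} \<times> {0..<int p}) = carrier K"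
  proof (rule card_subset_eq)
    show "finite (carrier K)" by (rule finite_K)
    show "card ((\<lambda>(x, y). lin x y) ` ({0..<int p} \<times> {0..<int p})) = card (carrier K)"
      using card_image[OF inj] card_K by (simp add: card_cartesian_product power2_eq_square)
  qed auto
  ultimately show ?thesis by (simp add: bij_betw_def)
qed

lemma linE:
  assumes "z \<in> carrier K"
  obtains x y where "z = lin x y"
  using assms lin_bij by (force simp: bij_betw_def image_def)

text \<open>The coordinates of \<open>z\<close> are determined only modulo \<open>p\<close>, but the value \<open>w\<close> is not
  affected by their choice.\<close>

definition conj :: "'a \<Rightarrow> 'a" where
  "conj z = (THE w. \<exists>x y. z = lin x y \<and> w = lin x (- y))"

lemma conj_lin: "conj (lin x y) = lin x (- y)"
  unfolding conj_def
proof (rule the_equality)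
  fix w assume "\<exists>x' y'. lin x y = lin x' y' \<and> w = lin x' (- y')"
  then show "w = lin x (- y)" by (auto simp: lin_eq_iff cong_minus_minus_iff cong_sym)
qed blast

lemma conj_closed [simp, intro]: "z \<in> carrier K \<Longrightarrow> conj z \<in> carrier K"
  by (auto elim!: linE simp: conj_lin)

lemma conj_conj [simp]: "z \<in> carrier K \<Longrightarrow> conj (conj z) = z"
  by (auto elim!: linE simp: conj_lin)

lemma conj_add [simp]: "\<lbrakk>z \<in> carrier K; w \<in> carrier K\<rbrakk> \<Longrightarrow> conj (z \<oplus> w) = conj z \<oplus> conj w"
  by (auto elim!: linE simp: conj_lin lin_add)

lemma conj_mult [simp]: "\<lbrakk>z \<in> carrier K; w \<in> carrier K\<rbrakk> \<Longrightarrow> conj (z \<otimes> w) = conj z \<otimes> conj w"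
  by (auto elim!: linE simp: conj_lin lin_mult)

lemma conj_one [simp]: "conj \<one> = \<one>" and conj_zero [simp]: "conj \<zero> = \<zero>"
  using conj_lin[of 1 0] conj_lin[of 0 0] by (simp_all add: lin_0_right)

lemma conj_minus [simp]: "z \<in> carrier K \<Longrightarrow> conj (\<ominus> z) = \<ominus> conj z"
  by (auto elim!: linE simp: conj_lin lin_minus)

lemma conj_pow [simp]: "z \<in> carrier K \<Longrightarrow> conj (z [^] (i::nat)) = conj z [^] i"
  by (induction i) auto

text \<open>Modulo \<open>2\<close> every integer is its own square.\<close>

lemma odd_p: "odd p"
proof
  assume "even p"
  then have p: "p = 2" using prime_p prime_odd_nat[of p] prime_ge_2_nat[of p] by force
  have "QuadRes 2 D"
    unfolding QuadRes_def
    by (rule exI[of _ D]) (auto simp: cong_iff_dvd_diff power2_eq_square)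
  with p show False using D_nonsquare by simp
qed

lemma conj_lin_eq_iff: "conj (lin x y) = lin x y \<longleftrightarrow> int p dvd y"
proof -
  have "conj (lin x y) = lin x y \<longleftrightarrow> int p dvd 2 * y"
    by (simp add: conj_lin lin_eq_iff cong_iff_dvd_diff)
  moreover have "coprime (int p) 2" using odd_p by simp
  ultimately show ?thesis by (simp add: coprime_dvd_mult_right_iff)
qed

end

section \<open>The affine group and its automorphisms\<close>

text \<open>The last two assumptions say that \<open>\<alpha>\<close> is a primitive \<open>N\<close>-th root of unity whose powers
  are all the \<open>N\<close>-th roots of unity of \<open>K\<close>.\<close>

locale affine_group = quadratic_field +
  fixes \<alpha> and m n :: int and N :: nat
  assumes alpha_lin: "\<alpha> = lin m n" and n_unit: "\<not> int p dvd n"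
    and N_pos: "N > 0" and N_coprime: "coprime N p"
    and alpha_pow_eq_one: "\<And>i::nat. \<alpha> [^] i = \<one> \<longleftrightarrow> N dvd i"
    and roots_of_unity: "\<And>u. u \<in> carrier K \<Longrightarrow> u [^] N = \<one> \<Longrightarrow> \<exists>i::nat. u = \<alpha> [^] i"
begin

definition U :: "'a set" where "U = {u \<in> carrier K. u [^] N = \<one>}"

text \<open>The pair \<open>(k, u)\<close> is the map \<open>x \<mapsto> u x + k\<close>, and the product is composition.\<close>

definition M :: "('a \<times> 'a) monoid" where
  "M = \<lparr>carrier = carrier K \<times> U,
        monoid.mult = \<lambda>(k, u) (k', u'). (k \<oplus> u \<otimes> k', u \<otimes> u'),
        one = (\<zero>, \<one>)\<rparr>"

lemma alpha_closed [simp, intro]: "\<alpha> \<in> carrier K"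
  by (simp add: alpha_lin)

lemma U_closed: "u \<in> U \<Longrightarrow> u \<in> carrier K"
  by (simp add: U_def)

lemma one_in_U [simp]: "\<one> \<in> U" and alpha_in_U [simp]: "\<alpha> \<in> U"
  by (simp_all add: U_def alpha_pow_eq_one)

lemma mult_in_U [simp]: "u \<in> U \<Longrightarrow> v \<in> U \<Longrightarrow> u \<otimes> v \<in> U"
  by (simp add: U_def nat_pow_distrib)

lemma conj_in_U [simp]: "u \<in> U \<Longrightarrow> conj u \<in> U"
  using conj_pow[of u N] by (simp add: U_def del: conj_pow)

declare U_closed [simp]

lemma pow_in_U [simp]: "u \<in> U \<Longrightarrow> u [^] (i::nat) \<in> U"
  by (induction i) auto

lemma U_powers: "u \<in> U \<Longrightarrow> \<exists>i::nat. u = \<alpha> [^] i"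
  using roots_of_unity by (auto simp: U_def simp del: U_closed)

lemma carrier_M: "carrier M = carrier K \<times> U"
  and one_M: "\<one>\<^bsub>M\<^esub> = (\<zero>, \<one>)"
  and mult_M: "(k, u) \<otimes>\<^bsub>M\<^esub> (k', u') = (k \<oplus> u \<otimes> k', u \<otimes> u')"
  by (simp_all add: M_def)

lemma group_M: "group M"
proof (rule groupI)
  fix z assume "z \<in> carrier M"
  then obtain k u where z: "z = (k, u)" "k \<in> carrier K" "u \<in> U" by (auto simp: carrier_M)
  let ?v = "u [^] (N - 1)"
  have "?v \<otimes> u = \<one>"
    using z N_pos by (simp add: U_def del: U_closed flip: nat_pow_Suc)
  then have "(\<ominus> (?v \<otimes> k), ?v) \<otimes>\<^bsub>M\<^esub> z = \<one>\<^bsub>M\<^esub>"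
    using z by (simp add: mult_M one_M l_neg)
  then show "\<exists>y\<in>carrier M. y \<otimes>\<^bsub>M\<^esub> z = \<one>\<^bsub>M\<^esub>"
    using z by (intro bexI[of _ "(\<ominus> (?v \<otimes> k), ?v)"]) (auto simp: carrier_M)
qed (auto simp: carrier_M mult_M one_M r_distr a_assoc m_assoc)

sublocale M: group M by (rule group_M)

lemma snd_pow_M: "z \<in> carrier M \<Longrightarrow> snd (z [^]\<^bsub>M\<^esub> (i::nat)) = snd z [^] i"
proof (induction i)
  case (Suc i)
  then show ?case
    by (cases "z [^]\<^bsub>M\<^esub> i"; cases z) (simp add: mult_M)
qed (simp add: one_M)

lemma pow_M_rotation: "u \<in> U \<Longrightarrow> (\<zero>, u) [^]\<^bsub>M\<^esub> (i::nat) = (\<zero>, u [^] i)"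
  by (induction i) (simp_all add: mult_M one_M)

lemma hom_translation: "(\<lambda>k. (k, \<one>)) \<in> hom (add_monoid K) M"
  by (rule homI) (simp_all add: carrier_M mult_M)

lemma pow_M_translation: "k \<in> carrier K \<Longrightarrow> (k, \<one>) [^]\<^bsub>M\<^esub> (i::int) = (emb i \<otimes> k, \<one>)"
  using hom_int_pow[OF hom_translation _ add.is_group group_M, of k i]
  by (simp add: add_pow_def[symmetric] add_pow_eq_emb)

lemma M_decompose: "k \<in> carrier K \<Longrightarrow> (k, \<alpha> [^] (i::nat)) = (k, \<one>) \<otimes>\<^bsub>M\<^esub> (\<zero>, \<alpha>) [^]\<^bsub>M\<^esub> i"
  by (simp add: pow_M_rotation mult_M)

text \<open>Since \<open>n\<close> is invertible modulo \<open>p\<close>, \<open>s\<close> can be solved for in terms of \<open>1\<close> and \<open>\<alpha>\<close>.\<close>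

lemma alpha_basis:
  assumes "k \<in> carrier K"
  obtains x y where "k = emb x \<oplus> emb y \<otimes> \<alpha>"
proof -
  obtain x y where k: "k = lin x y" using assms by (rule linE)
  have "coprime (int p) n" using prime_p n_unit by (simp add: prime_imp_coprime)
  then obtain u v where uv: "u * int p + v * n = 1"
    by (metis bezout_int coprime_iff_gcd_eq_1)
  have "emb (x - y * v * m) \<oplus> emb (y * v) \<otimes> \<alpha> = lin (x - y * v * m) 0 \<oplus> lin (y * v) 0 \<otimes> lin m n"
    by (simp add: lin_0_right alpha_lin)
  also have "\<dots> = lin x (y * (v * n))" by (simp add: lin_add lin_mult mult.assoc)
  also have "\<dots> = k"
  proof -
    have "y - y * (v * n) = y * u * int p"
      using uv by (metis mult.assoc mult.right_neutral right_diff_distrib add_diff_cancel_right')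
    then have "[y = y * (v * n)] (mod int p)" by (simp add: cong_iff_dvd_diff)
    then show ?thesis by (simp add: k lin_eq_iff cong_sym)
  qed
  finally show thesis using that by metis
qed

text \<open>The Galois group of \<open>K\<close>, indexed by \<open>bool\<close> with exclusive or as its operation.\<close>

definition Fr :: "bool \<Rightarrow> 'a \<Rightarrow> 'a" where "Fr e z = (if e then conj z else z)"

lemma Fr_closed [simp, intro]: "z \<in> carrier K \<Longrightarrow> Fr e z \<in> carrier K"
  and Fr_add [simp]: "\<lbrakk>z \<in> carrier K; w \<in> carrier K\<rbrakk> \<Longrightarrow> Fr e (z \<oplus> w) = Fr e z \<oplus> Fr e w"
  and Fr_mult [simp]: "\<lbrakk>z \<in> carrier K; w \<in> carrier K\<rbrakk> \<Longrightarrow> Fr e (z \<otimes> w) = Fr e z \<otimes> Fr e w"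
  and Fr_one [simp]: "Fr e \<one> = \<one>" and Fr_zero [simp]: "Fr e \<zero> = \<zero>"
  and Fr_minus [simp]: "z \<in> carrier K \<Longrightarrow> Fr e (\<ominus> z) = \<ominus> Fr e z"
  and Fr_emb [simp]: "Fr e (emb i) = emb i"
  and Fr_Fr [simp]: "z \<in> carrier K \<Longrightarrow> Fr e (Fr e' z) = Fr (e \<noteq> e') z"
  and Fr_U [simp]: "u \<in> U \<Longrightarrow> Fr e u \<in> U"
  using conj_lin[of i 0] by (auto simp: Fr_def lin_0_right)

lemma Fr_eq_iff: "\<lbrakk>z \<in> carrier K; w \<in> carrier K\<rbrakk> \<Longrightarrow> Fr e z = Fr e w \<longleftrightarrow> z = w"
  by (metis Fr_def conj_conj)

lemma Fr_alpha_eq_iff: "Fr e \<alpha> = Fr e' \<alpha> \<longleftrightarrow> e = e'"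
  using conj_lin_eq_iff[of m n] n_unit by (auto simp: Fr_def alpha_lin)

lemma Fr_alpha_neq_one: "Fr e \<alpha> \<noteq> \<one>"
proof
  assume "Fr e \<alpha> = \<one>"
  then have "\<alpha> = \<one>" using Fr_eq_iff[of \<alpha> \<one> e] by simp
  then have "lin m n = lin 1 0" by (simp add: alpha_lin lin_0_right)
  then show False using n_unit by (simp add: lin_eq_iff cong_iff_dvd_diff)
qed

text \<open>Conjugation of the map \<open>x \<mapsto> u x + k\<close> by \<open>x \<mapsto> \<mu> Fr e x + t\<close>.\<close>

definition phi :: "'a \<Rightarrow> 'a \<Rightarrow> bool \<Rightarrow> 'a \<times> 'a \<Rightarrow> 'a \<times> 'a" where
  "phi t \<mu> e = (\<lambda>(k, u)\<in>carrier M. (\<mu> \<otimes> Fr e k \<oplus> t \<otimes> (\<one> \<ominus> Fr e u), Fr e u))"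

lemma phi_apply:
  "k \<in> carrier K \<Longrightarrow> u \<in> U \<Longrightarrow> phi t \<mu> e (k, u) = (\<mu> \<otimes> Fr e k \<oplus> t \<otimes> (\<one> \<ominus> Fr e u), Fr e u)"
  by (simp add: phi_def carrier_M)

lemma phi_extensional: "phi t \<mu> e \<in> extensional (carrier M)"
  by (simp add: phi_def)

lemma phi_closed:
  "\<lbrakk>t \<in> carrier K; \<mu> \<in> carrier K; z \<in> carrier M\<rbrakk> \<Longrightarrow> phi t \<mu> e z \<in> carrier M"
  by (auto simp: carrier_M phi_apply)

lemma phi_comp:
  assumes "t \<in> carrier K" "\<mu> \<in> carrier K" "t' \<in> carrier K" "\<mu>' \<in> carrier K"
  shows "compose (carrier M) (phi t \<mu> e) (phi t' \<mu>' e')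
    = phi (t \<oplus> \<mu> \<otimes> Fr e t') (\<mu> \<otimes> Fr e \<mu>') (e \<noteq> e')"
proof (rule extensionalityI)
  fix z assume "z \<in> carrier M"
  then obtain k u where z: "z = (k, u)" "k \<in> carrier K" "u \<in> U" by (auto simp: carrier_M)
  let ?k = "Fr (e \<noteq> e') k" and ?u = "Fr (e \<noteq> e') u"
  have "phi t \<mu> e (phi t' \<mu>' e' (k, u)) =
      (\<mu> \<otimes> (Fr e \<mu>' \<otimes> ?k \<oplus> Fr e t' \<otimes> (\<one> \<ominus> ?u)) \<oplus> t \<otimes> (\<one> \<ominus> ?u), ?u)"
    using assms z by (simp add: phi_apply minus_eq)
  moreover have "\<mu> \<otimes> (Fr e \<mu>' \<otimes> ?k \<oplus> Fr e t' \<otimes> (\<one> \<ominus> ?u)) \<oplus> t \<otimes> (\<one> \<ominus> ?u)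
      = \<mu> \<otimes> Fr e \<mu>' \<otimes> ?k \<oplus> (t \<oplus> \<mu> \<otimes> Fr e t') \<otimes> (\<one> \<ominus> ?u)"
    using assms(1,2) Fr_closed[OF assms(4), of e] Fr_closed[OF assms(3), of e]
      Fr_closed[OF z(2), of "e \<noteq> e'"] Fr_closed[OF U_closed[OF z(3)], of "e \<noteq> e'"]
    by algebra
  ultimately show "compose (carrier M) (phi t \<mu> e) (phi t' \<mu>' e') z
      = phi (t \<oplus> \<mu> \<otimes> Fr e t') (\<mu> \<otimes> Fr e \<mu>') (e \<noteq> e') z"
    using z by (simp add: compose_def carrier_M phi_apply)
qed (auto simp: phi_extensional)

lemma phi_id: "phi \<zero> \<one> False = (\<lambda>z\<in>carrier M. z)"
  by (rule extensionalityI[OF phi_extensional]) (auto simp: carrier_M phi_apply Fr_def)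

lemma phi_hom:
  assumes "t \<in> carrier K" "\<mu> \<in> carrier K"
  shows "phi t \<mu> e \<in> hom M M"
proof (rule homI)
  fix z z' assume "z \<in> carrier M" "z' \<in> carrier M"
  then obtain k u k' u' where z: "z = (k, u)" "k \<in> carrier K" "u \<in> U"
    "z' = (k', u')" "k' \<in> carrier K" "u' \<in> U" by (auto simp: carrier_M)
  have "\<mu> \<otimes> (Fr e k \<oplus> Fr e u \<otimes> Fr e k') \<oplus> t \<otimes> (\<one> \<ominus> Fr e u \<otimes> Fr e u')
      = \<mu> \<otimes> Fr e k \<oplus> t \<otimes> (\<one> \<ominus> Fr e u) \<oplus> Fr e u \<otimes> (\<mu> \<otimes> Fr e k' \<oplus> t \<otimes> (\<one> \<ominus> Fr e u'))"
    using assms Fr_closed[OF z(2), of e] Fr_closed[OF z(5), of e]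
      Fr_closed[OF U_closed[OF z(3)], of e] Fr_closed[OF U_closed[OF z(6)], of e]
    by algebra
  with z show "phi t \<mu> e (z \<otimes>\<^bsub>M\<^esub> z') = phi t \<mu> e z \<otimes>\<^bsub>M\<^esub> phi t \<mu> e z'"
    by (simp add: mult_M phi_apply)
qed (rule phi_closed[OF assms])

lemma phi_auto:
  assumes "t \<in> carrier K" "\<mu> \<in> carrier K" "\<mu> \<noteq> \<zero>"
  shows "phi t \<mu> e \<in> carrier (AutoGroup M)"
proof -
  have inv: "inv \<mu> \<in> carrier K" "\<mu> \<otimes> inv \<mu> = \<one>"
    using assms field_Units by auto
  define \<mu>' where "\<mu>' = Fr e (inv \<mu>)"
  define t' where "t' = \<ominus> (\<mu>' \<otimes> Fr e t)"
  have cl: "\<mu>' \<in> carrier K" "t' \<in> carrier K" using inv assms by (simp_all add: \<mu>'_def t'_def)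
  have Fr0: "Fr False z = z" for z by (simp add: Fr_def)
  have mu: "\<mu> \<otimes> Fr e \<mu>' = \<one>" using inv by (simp add: \<mu>'_def Fr0)
  have mu': "\<mu>' \<otimes> Fr e \<mu> = \<one>"
    using inv assms by (simp add: \<mu>'_def m_comm flip: Fr_mult)
  have t: "t \<oplus> \<mu> \<otimes> Fr e t' = \<zero>"
  proof -
    have "\<mu> \<otimes> Fr e t' = \<ominus> (\<mu> \<otimes> Fr e \<mu>' \<otimes> t)"
      using assms cl by (simp add: t'_def Fr0 r_minus m_assoc)
    then show ?thesis using assms mu by (simp add: r_neg)
  qed
  have t': "t' \<oplus> \<mu>' \<otimes> Fr e t = \<zero>"
    using assms cl by (simp add: t'_def l_neg)
  have "compose (carrier M) (phi t \<mu> e) (phi t' \<mu>' e) = (\<lambda>z\<in>carrier M. z)"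
    "compose (carrier M) (phi t' \<mu>' e) (phi t \<mu> e) = (\<lambda>z\<in>carrier M. z)"
    using assms cl by (simp_all add: phi_comp mu mu' t t' phi_id)
  then have "phi t \<mu> e (phi t' \<mu>' e z) = z" "phi t' \<mu>' e (phi t \<mu> e z) = z"
    if "z \<in> carrier M" for z
    using that by (metis compose_eq restrict_apply')+
  then have "bij_betw (phi t \<mu> e) (carrier M) (carrier M)"
    using assms cl phi_closed by (intro bij_betw_byWitness[where f' = "phi t' \<mu>' e"]) auto
  then show ?thesis
    using assms by (simp add: carrier_AutoGroup_iff phi_hom phi_extensional)
qed

lemma phi_eqD:
  assumes "phi t \<mu> e = phi t' \<mu>' e'"
    and c: "t \<in> carrier K" "\<mu> \<in> carrier K" "t' \<in> carrier K" "\<mu>' \<in> carrier K"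
  shows "t = t' \<and> \<mu> = \<mu>' \<and> e = e'"
proof -
  have eq: "phi t \<mu> e z = phi t' \<mu>' e' z" for z using assms(1) by simp
  have "\<mu> = \<mu>'" using eq[of "(\<one>, \<one>)"] c by (simp add: phi_apply minus_eq r_neg)
  moreover have e: "e = e'" using eq[of "(\<zero>, \<alpha>)"] Fr_alpha_eq_iff by (simp add: phi_apply)
  moreover have "t = t'"
  proof -
    have "t \<otimes> (\<one> \<ominus> Fr e \<alpha>) = t' \<otimes> (\<one> \<ominus> Fr e \<alpha>)"
      using eq[of "(\<zero>, \<alpha>)"] c e by (simp add: phi_apply)
    moreover have "\<one> \<ominus> Fr e \<alpha> \<noteq> \<zero>"
      using Fr_alpha_neq_one[of e] r_right_minus_eq[of \<one> "Fr e \<alpha>"] by auto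
    ultimately show ?thesis using c by (simp add: m_rcancel)
  qed
  ultimately show ?thesis by simp
qed

text \<open>The translations are the elements of \<open>M\<close> killed by \<open>p\<close>: the multiplier of such an element
  is an \<open>N\<close>-th root of unity of order dividing \<open>p\<close>, and \<open>N\<close> is coprime to \<open>p\<close>.\<close>

lemma auto_translation:
  assumes f: "f \<in> hom M M" and k: "k \<in> carrier K"
  shows "f (k, \<one>) = (fst (f (k, \<one>)), \<one>)" "fst (f (k, \<one>)) \<in> carrier K"
proof -
  have z: "(k, \<one>) \<in> carrier M" using k by (simp add: carrier_M)
  then have fz: "f (k, \<one>) \<in> carrier M" using f by (auto simp: hom_def)
  then show "fst (f (k, \<one>)) \<in> carrier K" by (auto simp: carrier_M)
  have "(k, \<one>) [^]\<^bsub>M\<^esub> p = \<one>\<^bsub>M\<^esub>"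
    using pow_M_translation[OF k, of "int p"] k by (simp add: int_pow_int one_M)
  then have "f (k, \<one>) [^]\<^bsub>M\<^esub> p = \<one>\<^bsub>M\<^esub>"
    using hom_nat_pow[OF f z group_M group_M, of p] hom_one[OF f group_M group_M] by simp
  then have 1: "snd (f (k, \<one>)) [^] p = \<one>"
    using snd_pow_M[OF fz, of p] by (simp add: one_M)
  obtain i :: nat where i: "snd (f (k, \<one>)) = \<alpha> [^] i"
    using fz U_powers by (force simp: carrier_M)
  have "N dvd i * p" using 1 by (simp add: i nat_pow_pow alpha_pow_eq_one)
  then have "N dvd i" using N_coprime by (simp add: coprime_dvd_mult_left_iff)
  then have "snd (f (k, \<one>)) = \<one>" by (simp add: i alpha_pow_eq_one)
  then show "f (k, \<one>) = (fst (f (k, \<one>)), \<one>)" by (metis prod.collapse)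
qed

text \<open>The trace of \<open>\<alpha>\<close> is \<open>2 m\<close> and its norm is \<open>m\<^sup>2 - n\<^sup>2 D\<close>.\<close>

lemma alpha_quadratic:
  "\<alpha> \<otimes> \<alpha> = emb (2 * m) \<otimes> \<alpha> \<oplus> emb (n * n * D - m * m)"
  by (simp add: alpha_lin lin_mult lin_add flip: lin_0_right) (simp add: algebra_simps)

lemma alpha_conjugates:
  assumes b: "\<beta> \<in> carrier K" and eq: "\<beta> \<otimes> \<beta> = emb (2 * m) \<otimes> \<beta> \<oplus> emb (n * n * D - m * m)"
  obtains e where "\<beta> = Fr e \<alpha>"
proof -
  have sum: "\<alpha> \<oplus> conj \<alpha> = emb (2 * m)" and prod: "\<alpha> \<otimes> conj \<alpha> = \<ominus> emb (n * n * D - m * m)"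
    by (simp_all add: alpha_lin conj_lin lin_mult lin_add lin_minus flip: lin_0_right)
  have "(\<beta> \<ominus> \<alpha>) \<otimes> (\<beta> \<ominus> conj \<alpha>) = \<beta> \<otimes> \<beta> \<ominus> (\<alpha> \<oplus> conj \<alpha>) \<otimes> \<beta> \<oplus> \<alpha> \<otimes> conj \<alpha>"
    using b alpha_closed conj_closed[OF alpha_closed] by algebra
  also have "\<dots> = \<zero>" unfolding sum prod eq using b emb_closed[of "2 * m"] emb_closed[of "n * n * D - m * m"]
    by algebra
  finally have "\<beta> = \<alpha> \<or> \<beta> = conj \<alpha>" using b by (simp add: integral_iff r_right_minus_eq)
  then show thesis using that[of True] that[of False] by (auto simp: Fr_def)
qed

text \<open>The automorphism is read off from its values on the translations and on the rotation
  \<open>(0, \<alpha>)\<close>, which together generate \<open>M\<close>.\<close>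

lemma auto_is_phi:
  assumes "f \<in> carrier (AutoGroup M)"
  obtains t \<mu> e where "t \<in> carrier K" "\<mu> \<in> carrier K" "\<mu> \<noteq> \<zero>" "f = phi t \<mu> e"
proof -
  have f: "f \<in> hom M M" and inj: "inj_on f (carrier M)" and ext: "f \<in> extensional (carrier M)"
    using assms by (auto simp: carrier_AutoGroup_iff bij_betw_def)
  define T where "T k = fst (f (k, \<one>))" for k
  have T: "f (k, \<one>) = (T k, \<one>)" and T_closed [simp]: "T k \<in> carrier K" if "k \<in> carrier K" for k
    using auto_translation[OF f that] by (simp_all add: T_def)
  have T_add: "T (k \<oplus> k') = T k \<oplus> T k'" if "k \<in> carrier K" "k' \<in> carrier K" for k k'
  proof -
    have "f ((k, \<one>) \<otimes>\<^bsub>M\<^esub> (k', \<one>)) = f (k, \<one>) \<otimes>\<^bsub>M\<^esub> f (k', \<one>)"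
      using that by (intro hom_mult[OF f]) (simp_all add: carrier_M)
    then show ?thesis using that by (simp add: mult_M T)
  qed
  have "T \<in> hom (add_monoid K) (add_monoid K)"
    by (rule homI) (simp_all add: T_add)
  then have T_emb: "T (emb i \<otimes> k) = emb i \<otimes> T k" if "k \<in> carrier K" for i k
    using hom_int_pow[of T "add_monoid K" "add_monoid K" k i] that
    by (simp add: add.is_group add_pow_def[symmetric] add_pow_eq_emb)
  obtain r \<beta> where r: "f (\<zero>, \<alpha>) = (r, \<beta>)" "r \<in> carrier K" "\<beta> \<in> U"
    using hom_in_carrier[OF f, of "(\<zero>, \<alpha>)"] by (cases "f (\<zero>, \<alpha>)") (simp add: carrier_M)
  \<comment> \<open>The rotation conjugates the translation by \<open>k\<close> to the translation by \<open>\<alpha> k\<close>.\<close>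
  have T_alpha: "T (\<alpha> \<otimes> k) = \<beta> \<otimes> T k" if k: "k \<in> carrier K" for k
  proof -
    have "(\<zero>, \<alpha>) \<otimes>\<^bsub>M\<^esub> (k, \<one>) = (\<alpha> \<otimes> k, \<one>) \<otimes>\<^bsub>M\<^esub> (\<zero>, \<alpha>)"
      using k by (simp add: mult_M)
    then have "f (\<zero>, \<alpha>) \<otimes>\<^bsub>M\<^esub> f (k, \<one>) = f (\<alpha> \<otimes> k, \<one>) \<otimes>\<^bsub>M\<^esub> f (\<zero>, \<alpha>)"
      using k by (simp add: carrier_M flip: hom_mult[OF f])
    then have "r \<oplus> \<beta> \<otimes> T k = T (\<alpha> \<otimes> k) \<oplus> r"
      using k r by (simp add: T mult_M)
    then show ?thesis using k r by (simp add: a_comm[of _ r])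
  qed
  define \<mu> where "\<mu> = T \<one>"
  have mu [simp]: "\<mu> \<in> carrier K" by (simp add: \<mu>_def)
  have mu0: "\<mu> \<noteq> \<zero>"
  proof
    assume "\<mu> = \<zero>"
    then have "f (\<one>, \<one>) = (\<zero>, \<one>)" using T[of \<one>] by (simp add: \<mu>_def)
    also have "\<dots> = f (\<zero>, \<one>)" using hom_one[OF f group_M group_M] by (simp add: one_M)
    finally have "(\<one>, \<one>) = (\<zero>, \<one>)" by (rule inj_onD[OF inj]) (simp_all add: carrier_M)
    then show False by simp
  qed
  have b [simp]: "\<beta> \<in> carrier K" using r by simp
  \<comment> \<open>Applying \<open>T\<close> to the quadratic equation of \<open>\<alpha>\<close> transfers it to \<open>\<beta>\<close>.\<close>
  have "\<beta> \<otimes> \<beta> \<otimes> \<mu> = T (\<alpha> \<otimes> (\<alpha> \<otimes> \<one>))"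
    using T_alpha[of \<one>] T_alpha[of "\<alpha> \<otimes> \<one>"] by (simp add: \<mu>_def m_assoc)
  also have "\<dots> = T (emb (2 * m) \<otimes> (\<alpha> \<otimes> \<one>) \<oplus> emb (n * n * D - m * m) \<otimes> \<one>)"
    by (simp add: alpha_quadratic)
  also have "\<dots> = emb (2 * m) \<otimes> (\<beta> \<otimes> \<mu>) \<oplus> emb (n * n * D - m * m) \<otimes> \<mu>"
    unfolding \<mu>_def using T_alpha[of \<one>] by (simp only: T_add T_emb alpha_closed one_closed m_closed emb_closed)
  also have "\<dots> = (emb (2 * m) \<otimes> \<beta> \<oplus> emb (n * n * D - m * m)) \<otimes> \<mu>"
    by (simp add: l_distr m_assoc)
  finally have "\<beta> \<otimes> \<beta> = emb (2 * m) \<otimes> \<beta> \<oplus> emb (n * n * D - m * m)"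
    using mu0 by (simp add: m_rcancel)
  then obtain e where e: "\<beta> = Fr e \<alpha>" using alpha_conjugates[OF b] by metis
  have T_eq: "T k = \<mu> \<otimes> Fr e k" if "k \<in> carrier K" for k
  proof -
    obtain x y where k: "k = emb x \<oplus> emb y \<otimes> \<alpha>" using \<open>k \<in> carrier K\<close> by (rule alpha_basis)
    have "T k = T (emb x \<otimes> \<one> \<oplus> emb y \<otimes> (\<alpha> \<otimes> \<one>))" by (simp add: k)
    also have "\<dots> = emb x \<otimes> \<mu> \<oplus> emb y \<otimes> (\<beta> \<otimes> \<mu>)"
      unfolding \<mu>_def using T_alpha[of \<one>] by (simp only: T_add T_emb alpha_closed one_closed m_closed emb_closed)
    also have "\<dots> = \<mu> \<otimes> Fr e k"
      unfolding k e by (simp add: r_distr m_ac)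
    finally show ?thesis .
  qed
  have nz: "\<one> \<ominus> \<beta> \<noteq> \<zero>" using Fr_alpha_neq_one[of e] e by (simp add: r_right_minus_eq)
  \<comment> \<open>A rotation about \<open>t\<close> by \<open>\<beta>\<close> is \<open>x \<mapsto> \<beta> x + t (1 - \<beta>)\<close>, so \<open>t\<close> is the fixed point of
    the image of the rotation \<open>\<alpha>\<close>.\<close>
  define t where "t = r \<otimes> inv (\<one> \<ominus> \<beta>)"
  have inv: "inv (\<one> \<ominus> \<beta>) \<in> carrier K" "inv (\<one> \<ominus> \<beta>) \<otimes> (\<one> \<ominus> \<beta>) = \<one>"
    using nz field_Units by auto
  have t [simp]: "t \<in> carrier K" using r inv by (simp add: t_def)
  have t_eq: "t \<otimes> (\<one> \<ominus> \<beta>) = r" using r inv by (simp add: t_def m_assoc)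
  have "f = phi t \<mu> e"
  proof (rule extensionalityI[OF ext phi_extensional])
    fix z assume "z \<in> carrier M"
    then obtain k u where k: "k \<in> carrier K" and "u \<in> U" "z = (k, u)"
      by (auto simp: carrier_M)
    then obtain i :: nat where z: "z = (k, \<alpha> [^] i)" using U_powers by blast
    have agree: "f (k, \<one>) = phi t \<mu> e (k, \<one>)" "f (\<zero>, \<alpha>) = phi t \<mu> e (\<zero>, \<alpha>)"
      using k r by (simp add: T T_eq phi_apply minus_eq r_neg) (simp add: r phi_apply t_eq flip: e)
    have "h z = h (k, \<one>) \<otimes>\<^bsub>M\<^esub> h (\<zero>, \<alpha>) [^]\<^bsub>M\<^esub> i" if h: "h \<in> hom M M" for h
    proof -
      have c: "(k, \<one>) \<in> carrier M" "(\<zero>, \<alpha>) \<in> carrier M" using k by (simp_all add: carrier_M)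
      show ?thesis
        unfolding z M_decompose[OF k] hom_mult[OF h c(1) M.nat_pow_closed[OF c(2)]]
          hom_nat_pow[OF h c(2) group_M group_M] ..
    qed
    from this[OF f] this[OF phi_hom[OF t mu, of e]] show "f z = phi t \<mu> e z"
      by (simp only: agree)
  qed
  with t mu mu0 show thesis by (rule that)
qed

end

section \<open>Normal forms\<close>

lemma (in group) hom_conjugation:
  assumes "y \<in> carrier G"
  shows "(\<lambda>z. inv y \<otimes> z \<otimes> y) \<in> hom G G"
proof (rule homI)
  have "y \<otimes> (inv y \<otimes> w) = w" if "w \<in> carrier G" for w
    using assms that by (simp flip: m_assoc)
  then show "inv y \<otimes> (z \<otimes> w) \<otimes> y = inv y \<otimes> z \<otimes> y \<otimes> (inv y \<otimes> w \<otimes> y)"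
    if "z \<in> carrier G" "w \<in> carrier G" for z w
    using assms that by (simp add: m_assoc)
qed (use assms in simp)

lemma (in group) commute_int_pow:
  assumes "x \<in> carrier G" "y \<in> carrier G" "x \<otimes> y = y \<otimes> x"
  shows "x [^] (i::int) \<otimes> y = y \<otimes> x [^] i"
proof -
  have hom: "(\<lambda>z. inv y \<otimes> z \<otimes> y) \<in> hom G G"
    using assms(2) by (rule hom_conjugation)
  have "inv y \<otimes> x \<otimes> y = x" using assms by (simp add: m_assoc inv_solve_left')
  then have "inv y \<otimes> x [^] i \<otimes> y = x [^] i"
    using hom_int_pow[OF hom assms(1) is_group is_group, of i] by simp
  then show ?thesis using assms by (simp add: m_assoc inv_solve_left')
qed

lemma (in group) int_pow_mod:
  assumes "x \<in> carrier G" "x [^] (k::nat) = \<one>"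
  shows "x [^] (i::int) = x [^] (i mod int k)"
proof -
  have "x [^] i = x [^] (int k * (i div int k) + i mod int k)" by simp
  also have "\<dots> = (x [^] int k) [^] (i div int k) \<otimes> x [^] (i mod int k)"
    using assms(1) by (simp only: int_pow_mult int_pow_pow)
  finally show ?thesis using assms by (simp add: int_pow_int)
qed

definition normal_forms :: "('a, 'b) monoid_scheme \<Rightarrow> 'a \<Rightarrow> 'a \<Rightarrow> 'a \<Rightarrow> 'a set" where
  "normal_forms G A B C =
    {B [^]\<^bsub>G\<^esub> x \<otimes>\<^bsub>G\<^esub> C [^]\<^bsub>G\<^esub> y \<otimes>\<^bsub>G\<^esub> A [^]\<^bsub>G\<^esub> z | (x::int) (y::int) (z::int). True}"

lemma (in group) card_normal_forms:
  assumes "A \<in> carrier G" "B \<in> carrier G" "C \<in> carrier G"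
    and "A [^] (N::nat) = \<one>" "B [^] (p::nat) = \<one>" "C [^] p = \<one>" "N > 0" "p > 0"
  shows "finite (normal_forms G A B C)" "card (normal_forms G A B C) \<le> p * p * N"
proof -
  let ?I = "{0..<int p} \<times> {0..<int p} \<times> {0..<int N}"
  let ?f = "\<lambda>(x, y, z). B [^] x \<otimes> C [^] y \<otimes> A [^] z"
  have sub: "normal_forms G A B C \<subseteq> ?f ` ?I"
  proof
    fix w assume "w \<in> normal_forms G A B C"
    then obtain x y z :: int where w: "w = B [^] x \<otimes> C [^] y \<otimes> A [^] z"
      by (auto simp: normal_forms_def)
    have "w = ?f (x mod int p, y mod int p, z mod int N)"
      using assms(1-6) by (simp add: w int_pow_mod[symmetric])
    moreover have "(x mod int p, y mod int p, z mod int N) \<in> ?I" using assms(7,8) by simp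
    ultimately show "w \<in> ?f ` ?I" by blast
  qed
  then show "finite (normal_forms G A B C)" by (rule finite_subset) simp
  have "card (normal_forms G A B C) \<le> card (?f ` ?I)" by (rule card_mono[OF _ sub]) simp
  also have "\<dots> \<le> card ?I" by (rule card_image_le) simp
  finally show "card (normal_forms G A B C) \<le> p * p * N" by (simp add: card_cartesian_product)
qed

text \<open>Conjugation by \<open>A\<close> maps \<open>B\<^sup>x C\<^sup>y\<close> to an element of the same shape, so \<open>A\<^sup>-\<^sup>1\<close> can be moved
  to the right of it.  The relations do not express \<open>A B A\<^sup>-\<^sup>1\<close> directly, so left
  multiplication by \<open>A\<close> is obtained as multiplication by the power \<open>N - 1\<close> of \<open>A\<^sup>-\<^sup>1\<close>.\<close>

lemma (in group) normal_forms_absorb: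
  fixes i j k l :: int
  assumes c: "A \<in> carrier G" "B \<in> carrier G" "C \<in> carrier G"
    and N: "A [^] (N::nat) = \<one>" "N > 0" and BC: "B \<otimes> C = C \<otimes> B"
    and AB: "inv A \<otimes> B \<otimes> A = B [^] i \<otimes> C [^] j" and AC: "inv A \<otimes> C \<otimes> A = B [^] k \<otimes> C [^] l"
    and w: "w \<in> normal_forms G A B C"
  shows "B [^] (d::int) \<otimes> w \<in> normal_forms G A B C" "C [^] (d::int) \<otimes> w \<in> normal_forms G A B C"
    "inv A \<otimes> w \<in> normal_forms G A B C" "A \<otimes> w \<in> normal_forms G A B C"
proof -
  have comm: "C [^] y \<otimes> B [^] x = B [^] x \<otimes> C [^] y" for x y :: int
    using commute_int_pow[of C "B [^] x" y] commute_int_pow[of B C x] c BC by simp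
  have absorb: "(B [^] d \<otimes> C [^] e) \<otimes> v \<in> normal_forms G A B C"
    if v: "v \<in> normal_forms G A B C" for v and d e :: int
  proof -
    obtain x y z :: int where v: "v = B [^] x \<otimes> C [^] y \<otimes> A [^] z"
      using v by (auto simp: normal_forms_def)
    have "(B [^] d \<otimes> C [^] e) \<otimes> v = B [^] d \<otimes> (C [^] e \<otimes> B [^] x) \<otimes> C [^] y \<otimes> A [^] z"
      using c by (simp add: v m_assoc)
    also have "\<dots> = (B [^] d \<otimes> B [^] x) \<otimes> (C [^] e \<otimes> C [^] y) \<otimes> A [^] z"
      unfolding comm using c by (simp add: m_assoc)
    also have "\<dots> = B [^] (d + x) \<otimes> C [^] (e + y) \<otimes> A [^] z"
      using c by (simp add: int_pow_mult)
    finally show ?thesis by (auto simp: normal_forms_def)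
  qed
  show "B [^] d \<otimes> w \<in> normal_forms G A B C" using absorb[OF w, of d 0] c by simp
  show "C [^] d \<otimes> w \<in> normal_forms G A B C" using absorb[OF w, of 0 d] c by simp
  have hom: "(\<lambda>z. inv A \<otimes> z \<otimes> A) \<in> hom G G"
    using c(1) by (rule hom_conjugation)
  have conj: "inv A \<otimes> v \<in> normal_forms G A B C" if v: "v \<in> normal_forms G A B C" for v
  proof -
    obtain x y z :: int where v: "v = B [^] x \<otimes> C [^] y \<otimes> A [^] z"
      using v by (auto simp: normal_forms_def)
    have powers: "(B [^] i \<otimes> C [^] j) [^] x = B [^] (i * x) \<otimes> C [^] (j * x)" for i j x :: int
      using c comm by (simp add: int_pow_mult_distrib int_pow_pow)
    have "inv A \<otimes> v = (inv A \<otimes> (B [^] x \<otimes> C [^] y) \<otimes> A) \<otimes> (inv A \<otimes> A [^] z)"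
    proof -
      have "A \<otimes> (inv A \<otimes> A [^] z) = A [^] z" using c by (simp flip: m_assoc)
      then show ?thesis using c by (simp add: v m_assoc)
    qed
    also have "inv A \<otimes> (B [^] x \<otimes> C [^] y) \<otimes> A = (inv A \<otimes> B [^] x \<otimes> A) \<otimes> (inv A \<otimes> C [^] y \<otimes> A)"
      using c hom_mult[OF hom, of "B [^] x" "C [^] y"] by simp
    also have "inv A \<otimes> B [^] x \<otimes> A = B [^] (i * x) \<otimes> C [^] (j * x)"
      using hom_int_pow[OF hom c(2) is_group is_group, of x] AB by (simp add: powers)
    also have "inv A \<otimes> C [^] y \<otimes> A = B [^] (k * y) \<otimes> C [^] (l * y)"
      using hom_int_pow[OF hom c(3) is_group is_group, of y] AC by (simp add: powers)
    also have "inv A \<otimes> A [^] z = A [^] (z - 1)"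
      using c int_pow_mult[of A "-1" z] by (simp add: int_pow_neg)
    finally have "inv A \<otimes> v = (B [^] (i * x) \<otimes> C [^] (j * x)) \<otimes>
        ((B [^] (k * y) \<otimes> C [^] (l * y)) \<otimes> A [^] (z - 1))"
      using c by (simp add: m_assoc)
    moreover have "(B [^] (k * y) \<otimes> C [^] (l * y)) \<otimes> A [^] (z - 1) \<in> normal_forms G A B C"
      by (auto simp: normal_forms_def)
    ultimately show ?thesis by (simp add: absorb)
  qed
  show "inv A \<otimes> w \<in> normal_forms G A B C" using w by (rule conj)
  have wc: "w \<in> carrier G" using w c by (auto simp: normal_forms_def)
  have "inv A [^] (d::nat) \<otimes> w \<in> normal_forms G A B C" for d
  proof (induction d)
    case (Suc d)
    have "inv A [^] Suc d \<otimes> w = inv A \<otimes> (inv A [^] d \<otimes> w)"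
      using c wc by (simp only: nat_pow_Suc2 inv_closed m_assoc nat_pow_closed)
    with Suc conj show ?case by simp
  qed (use w wc in simp)
  moreover have "inv A [^] (N - 1) = A"
  proof -
    have "A [^] (N - 1) \<otimes> A = \<one>" using N c by (simp flip: nat_pow_Suc)
    then show ?thesis using c by (metis inv_equality inv_inv nat_pow_closed nat_pow_inv)
  qed
  ultimately show "A \<otimes> w \<in> normal_forms G A B C" by metis
qed

section \<open>Universal property of presentations\<close>

primrec eval_word :: "('g, 'r) monoid_scheme \<Rightarrow> ('x \<Rightarrow> 'g) \<Rightarrow> 'x signed_word \<Rightarrow> 'g" where
  "eval_word H h [] = \<one>\<^bsub>H\<^esub>"
| "eval_word H h (l # w) = (if snd l then h (fst l) else inv\<^bsub>H\<^esub> h (fst l)) \<otimes>\<^bsub>H\<^esub> eval_word H h w"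

context group
begin

lemma eval_word_closed: "range h \<subseteq> carrier G \<Longrightarrow> eval_word G h w \<in> carrier G"
  by (induction w) auto

lemma eval_word_append:
  assumes "range h \<subseteq> carrier G"
  shows "eval_word G h (u @ v) = eval_word G h u \<otimes> eval_word G h v"
proof -
  have "h x \<in> carrier G" for x using assms by auto
  then show ?thesis by (induction u) (auto simp: eval_word_closed[OF assms] m_assoc)
qed

lemma eval_word_free_equiv:
  assumes h: "range h \<subseteq> carrier G" and "free_equiv u v"
  shows "eval_word G h u = eval_word G h v"
  using assms(2)
proof induction
  case (cancel u x e v)
  have "h x \<in> carrier G" using h by auto
  then show ?case
    by (cases e) (simp_all add: eval_word_append[OF h] eval_word_closed[OF h] m_assoc inv_solve_left flip: m_assoc)
qed auto

lemma free_group_universal: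
  fixes h :: "'x \<Rightarrow> 'a"
  assumes h: "range h \<subseteq> carrier G"
  obtains f where "f \<in> hom free_group G" "\<And>x. f (free_gen x) = h x"
proof -
  define f where "f U = eval_word G h (SOME w. w \<in> U)" for U
  have f: "f (word_class u) = eval_word G h u" for u
  proof -
    have "u \<in> word_class u" by (simp add: word_class_def free_equiv.refl)
    then have "(SOME w. w \<in> word_class u) \<in> word_class u" by (rule someI)
    then show ?thesis
      using eval_word_free_equiv[OF h] by (simp add: f_def word_class_def)
  qed
  show thesis
  proof
    show "f \<in> hom free_group G"
    proof (rule homI)
      fix U V :: "'x signed_word set" assume "U \<in> carrier free_group" "V \<in> carrier free_group"
      then obtain u v where "U = word_class u" "V = word_class v" by (auto simp: free_group_def)
      then show "f (U \<otimes>\<^bsub>free_group\<^esub> V) = f U \<otimes> f V"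
        by (simp add: free_group_mult f eval_word_append[OF h])
    qed (auto simp: free_group_def f eval_word_closed[OF h])
    show "f (free_gen x) = h x" for x
      using h by (simp add: free_gen_def f image_subset_iff)
  qed
qed

end

abbreviation relators :: "('x signed_word set \<times> 'x signed_word set) set \<Rightarrow> 'x signed_word set set" where
  "relators E \<equiv> {u \<otimes>\<^bsub>free_group\<^esub> inv\<^bsub>free_group\<^esub> v | u v. (u, v) \<in> E}"

text \<open>The projection of the free group onto the presented group.\<close>

definition presented_class ::
    "('x signed_word set \<times> 'x signed_word set) set \<Rightarrow> 'x signed_word set \<Rightarrow> 'x signed_word set set" where
  "presented_class E u = normal_closure free_group (relators E) #>\<^bsub>free_group\<^esub> u"

locale presentation =
  fixes E :: "('x signed_word set \<times> 'x signed_word set) set"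
  assumes E_closed: "E \<subseteq> carrier free_group \<times> carrier free_group"
begin

lemma relators_closed: "relators E \<subseteq> carrier free_group"
proof -
  interpret F: group "free_group :: 'x signed_word set monoid" by (rule group_free_group)
  show ?thesis using E_closed by auto
qed

lemma normal_relators: "normal_closure free_group (relators E) \<lhd> free_group"
  by (rule group.normal_normal_closure[OF group_free_group relators_closed])

lemma group_presented: "group (presented_group E)"
  unfolding presented_group_def by (rule normal.factorgroup_is_group[OF normal_relators])

lemma hom_presented_class: "presented_class E \<in> hom free_group (presented_group E)"
  unfolding presented_group_def presented_class_def
  using normal.r_coset_hom_Mod[OF normal_relators] .

lemma presented_relation:
  assumes uv: "(u, v) \<in> E"
  shows "presented_class E u = presented_class E v"
proof -
  interpret F: group "free_group :: 'x signed_word set monoid" by (rule group_free_group)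
  let ?n = "normal_closure free_group (relators E)"
  have sub: "subgroup ?n free_group" using normal_relators by (rule normal_imp_subgroup)
  have c: "u \<in> carrier free_group" "v \<in> carrier free_group" using E_closed uv by auto
  have r: "u \<otimes>\<^bsub>free_group\<^esub> inv\<^bsub>free_group\<^esub> v \<in> relators E" using uv by auto
  have mem: "u \<otimes>\<^bsub>free_group\<^esub> inv\<^bsub>free_group\<^esub> v \<in> ?n"
    unfolding normal_closure_def
  proof (rule generate.incl, rule CollectI, intro exI conjI)
    show "\<one>\<^bsub>free_group\<^esub> \<in> carrier (free_group :: 'x signed_word set monoid)" by simp
    show "u \<otimes>\<^bsub>free_group\<^esub> inv\<^bsub>free_group\<^esub> v \<in> relators E" by (rule r)
    show "u \<otimes>\<^bsub>free_group\<^esub> inv\<^bsub>free_group\<^esub> v = \<one>\<^bsub>free_group\<^esub> \<otimes>\<^bsub>free_group\<^esub>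
      (u \<otimes>\<^bsub>free_group\<^esub> inv\<^bsub>free_group\<^esub> v) \<otimes>\<^bsub>free_group\<^esub> inv\<^bsub>free_group\<^esub> \<one>\<^bsub>free_group\<^esub>"
      using c by simp
  qed
  have "u \<in> ?n #>\<^bsub>free_group\<^esub> v"
    unfolding r_coset_def by (rule UN_I[OF mem]) (use c in \<open>simp add: F.m_assoc\<close>)
  from F.repr_independence[OF this c(2) sub] show ?thesis
    by (simp only: presented_class_def)
qed

text \<open>The presented group is generated by the classes of the generators: every element is the
  class of a word, and the induction runs along that word.\<close>

lemma presented_induct:
  assumes "z \<in> carrier (presented_group E)"
    and one: "P \<one>\<^bsub>presented_group E\<^esub>"
    and gen: "\<And>x w. w \<in> carrier (presented_group E) \<Longrightarrow> P w \<Longrightarrow>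
      P (presented_class E (free_gen x) \<otimes>\<^bsub>presented_group E\<^esub> w)"
    and gen_inv: "\<And>x w. w \<in> carrier (presented_group E) \<Longrightarrow> P w \<Longrightarrow>
      P (inv\<^bsub>presented_group E\<^esub> presented_class E (free_gen x) \<otimes>\<^bsub>presented_group E\<^esub> w)"
  shows "P z"
proof -
  interpret F: group "free_group :: 'x signed_word set monoid" by (rule group_free_group)
  interpret h: group_hom "free_group :: 'x signed_word set monoid" "presented_group E" "presented_class E"
    using group_presented hom_presented_class by (simp add: group_hom_def group_hom_axioms_def F.is_group)
  have car: "word_class w \<in> carrier free_group" for w :: "'x signed_word" by (simp add: free_group_def)
  have "P (presented_class E (word_class w))" for w
  proof (induction w)
    case Nil
    show ?case using one h.hom_one by (simp add: free_group_def del: h.hom_one)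
  next
    case (Cons l w)
    obtain x e where l: "l = (x, e)" by (cases l)
    have "word_class [(x, False)] \<otimes>\<^bsub>free_group\<^esub> free_gen x = \<one>\<^bsub>free_group\<^esub>"
      using free_equiv.cancel[of "[]" x False "[]"]
      by (simp add: free_gen_def free_group_mult word_class_eq_iff) (simp add: free_group_def word_class_eq_iff)
    then have inv: "word_class [(x, False)] = inv\<^bsub>free_group\<^esub> free_gen x"
      by (metis F.inv_equality car free_gen_def)
    have g: "free_gen x \<in> carrier free_group" by (simp add: free_gen_def car)
    have "word_class (l # w) = word_class [l] \<otimes>\<^bsub>free_group\<^esub> word_class w"
      by (simp add: free_group_mult)
    then have "presented_class E (word_class (l # w)) =
        presented_class E (word_class [l]) \<otimes>\<^bsub>presented_group E\<^esub> presented_class E (word_class w)"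
      by (simp add: car)
    moreover have "presented_class E (word_class [l]) = (if e then presented_class E (free_gen x)
        else inv\<^bsub>presented_group E\<^esub> presented_class E (free_gen x))"
      using g by (simp add: l inv) (simp add: free_gen_def)
    ultimately show ?case using gen gen_inv Cons car by (cases e) simp_all
  qed
  moreover have "z \<in> presented_class E ` range word_class"
    using assms(1) by (auto simp: presented_group_def presented_class_def FactGroup_def RCOSETS_def free_group_def)
  ultimately show "P z" by auto
qed

lemma presented_universal:
  assumes "group H" and f: "f \<in> hom free_group H"
    and rel: "\<And>u v. (u, v) \<in> E \<Longrightarrow> f u = f v"
  obtains g where "g \<in> hom (presented_group E) H"
    "\<And>u. u \<in> carrier free_group \<Longrightarrow> g (presented_class E u) = f u"
proof -
  interpret F: group "free_group :: 'x signed_word set monoid" by (rule group_free_group)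
  interpret f: group_hom "free_group :: 'x signed_word set monoid" H f
    using assms by (simp add: group_hom_def group_hom_axioms_def F.is_group)
  have ker: "f (u \<otimes>\<^bsub>free_group\<^esub> inv\<^bsub>free_group\<^esub> v) = \<one>\<^bsub>H\<^esub>" if "(u, v) \<in> E" for u v
    using that rel[OF that] E_closed by (auto simp: f.H.r_inv)
  have "normal_closure free_group (relators E) \<subseteq> kernel free_group H f"
    unfolding normal_closure_def
  proof (rule F.generate_subgroup_incl[OF _ f.subgroup_kernel], rule subsetI)
    fix w assume "w \<in> {g \<otimes>\<^bsub>free_group\<^esub> r \<otimes>\<^bsub>free_group\<^esub> inv\<^bsub>free_group\<^esub> g |
      g r. g \<in> carrier free_group \<and> r \<in> relators E}"
    then obtain g r where g: "g \<in> carrier free_group" and r: "r \<in> relators E"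
      and w: "w = g \<otimes>\<^bsub>free_group\<^esub> r \<otimes>\<^bsub>free_group\<^esub> inv\<^bsub>free_group\<^esub> g" by blast
    from r have "r \<in> carrier free_group" "f r = \<one>\<^bsub>H\<^esub>" using relators_closed ker by auto
    then show "w \<in> kernel free_group H f" using g by (simp add: w kernel_def)
  qed
  from f.FactGroup_universal_kernel[OF normal_relators this] that show thesis
    unfolding presented_class_def presented_group_def by blast
qed

end

section \<open>The presented group is the affine group\<close>

context affine_group
begin

lemma card_M: "card (carrier M) = p * p * N"
proof -
  have inj: "inj_on (\<lambda>i::nat. \<alpha> [^] i) {..<N}"
  proof (rule linorder_inj_onI')
    fix i j assume "i \<in> {..<N}" "j \<in> {..<N}" "i < j"
    then have "\<not> N dvd j - i" by (auto dest: dvd_imp_le)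
    then have ne: "\<alpha> [^] (j - i) \<noteq> \<one>" by (simp add: alpha_pow_eq_one)
    show "\<alpha> [^] i \<noteq> \<alpha> [^] j"
    proof
      assume "\<alpha> [^] i = \<alpha> [^] j"
      moreover have "\<alpha> [^] i \<otimes> \<alpha> [^] (j - i) = \<alpha> [^] j"
        using \<open>i < j\<close> by (simp add: nat_pow_mult)
      ultimately have "\<alpha> [^] i \<otimes> \<alpha> [^] (j - i) = \<alpha> [^] i \<otimes> \<one>" by simp
      moreover have "\<alpha> [^] i \<noteq> \<zero>"
      proof
        assume "\<alpha> [^] i = \<zero>"
        then have "\<alpha> [^] i \<otimes> \<alpha> [^] (N - i) = \<zero>" by simp
        then have "\<alpha> [^] N = \<zero>" using \<open>i \<in> {..<N}\<close> by (simp add: nat_pow_mult)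
        then show False using alpha_pow_eq_one[of N] by simp
      qed
      ultimately show False using ne m_lcancel[of "\<alpha> [^] i" "\<alpha> [^] (j - i)" \<one>] by simp
    qed
  qed
  have "U = (\<lambda>i::nat. \<alpha> [^] i) ` {..<N}"
  proof
    show "U \<subseteq> (\<lambda>i::nat. \<alpha> [^] i) ` {..<N}"
    proof
      fix u assume "u \<in> U"
      then obtain i :: nat where "u = \<alpha> [^] i" using U_powers by blast
      moreover have "\<alpha> [^] i = (\<alpha> [^] N) [^] (i div N) \<otimes> \<alpha> [^] (i mod N)"
        by (simp add: nat_pow_pow nat_pow_mult)
      moreover have "\<alpha> [^] N = \<one>" by (simp add: alpha_pow_eq_one)
      ultimately have "u = \<alpha> [^] (i mod N)" by simp
      then show "u \<in> (\<lambda>i::nat. \<alpha> [^] i) ` {..<N}" using N_pos by auto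
    qed
  qed auto
  with inj have U: "card U = N" by (simp add: card_image)
  then show "card (carrier M) = p * p * N"
    by (simp add: carrier_M card_cartesian_product U card_K power2_eq_square)
qed


text \<open>The generator \<open>a\<close> goes to the inverse of the rotation \<open>(0, \<alpha>)\<close>, because in the relations
  it is \<open>a\<^sup>-\<^sup>1 b a\<close>, not \<open>a b a\<^sup>-\<^sup>1\<close>, that is multiplication by \<open>\<alpha>\<close>.\<close>

lemma presented_group_iso:
  assumes N: "N = q\<^sup>2"
  shows "group (G_group p q D m n)" "G_group p q D m n \<cong> M"
proof -
  let ?F = "free_group :: abc signed_word set monoid"
  let ?a = "free_gen GenA" and ?b = "free_gen GenB" and ?c = "free_gen GenC"
  interpret F: group ?F by (rule group_free_group)
  have gens: "free_gen x \<in> carrier ?F" for x by (simp add: free_gen_def free_group_def)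
  define E where "E = {(?a [^]\<^bsub>?F\<^esub> q\<^sup>2, \<one>\<^bsub>?F\<^esub>), (?b [^]\<^bsub>?F\<^esub> p, \<one>\<^bsub>?F\<^esub>), (?c [^]\<^bsub>?F\<^esub> p, \<one>\<^bsub>?F\<^esub>),
       (inv\<^bsub>?F\<^esub> ?b \<otimes>\<^bsub>?F\<^esub> inv\<^bsub>?F\<^esub> ?c \<otimes>\<^bsub>?F\<^esub> ?b \<otimes>\<^bsub>?F\<^esub> ?c, \<one>\<^bsub>?F\<^esub>),
       (inv\<^bsub>?F\<^esub> ?a \<otimes>\<^bsub>?F\<^esub> ?b \<otimes>\<^bsub>?F\<^esub> ?a, ?b [^]\<^bsub>?F\<^esub> m \<otimes>\<^bsub>?F\<^esub> ?c [^]\<^bsub>?F\<^esub> (n * D)),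
       (inv\<^bsub>?F\<^esub> ?a \<otimes>\<^bsub>?F\<^esub> ?c \<otimes>\<^bsub>?F\<^esub> ?a, ?b [^]\<^bsub>?F\<^esub> n \<otimes>\<^bsub>?F\<^esub> ?c [^]\<^bsub>?F\<^esub> m)}"
  have G: "G_group p q D m n = presented_group E"
    by (simp add: G_group_def E_def Let_def)
  interpret presentation E
    by unfold_locales (simp add: E_def gens)
  define P where "P = presented_group E"
  interpret P: group P unfolding P_def by (rule group_presented)
  show "group (G_group p q D m n)" by (simp add: G group_presented)
  define pc where "pc = presented_class E"
  interpret \<pi>: group_hom ?F P pc
    unfolding pc_def using hom_presented_class P.is_group
    by (simp add: group_hom_def group_hom_axioms_def F.is_group P_def)
  define A B C where "A = pc ?a" "B = pc ?b" "C = pc ?c"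
  note ABC = this
  have cl: "A \<in> carrier P" "B \<in> carrier P" "C \<in> carrier P" by (simp_all add: ABC gens)
  have relE: "\<forall>(u, v)\<in>E. pc u = pc v" unfolding pc_def using presented_relation by blast
  have rel: "A [^]\<^bsub>P\<^esub> N = \<one>\<^bsub>P\<^esub>" "B [^]\<^bsub>P\<^esub> p = \<one>\<^bsub>P\<^esub>" "C [^]\<^bsub>P\<^esub> p = \<one>\<^bsub>P\<^esub>"
    "inv\<^bsub>P\<^esub> B \<otimes>\<^bsub>P\<^esub> inv\<^bsub>P\<^esub> C \<otimes>\<^bsub>P\<^esub> B \<otimes>\<^bsub>P\<^esub> C = \<one>\<^bsub>P\<^esub>"
    "inv\<^bsub>P\<^esub> A \<otimes>\<^bsub>P\<^esub> B \<otimes>\<^bsub>P\<^esub> A = B [^]\<^bsub>P\<^esub> m \<otimes>\<^bsub>P\<^esub> C [^]\<^bsub>P\<^esub> (n * D)"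
    "inv\<^bsub>P\<^esub> A \<otimes>\<^bsub>P\<^esub> C \<otimes>\<^bsub>P\<^esub> A = B [^]\<^bsub>P\<^esub> n \<otimes>\<^bsub>P\<^esub> C [^]\<^bsub>P\<^esub> m"
    using relE unfolding E_def
    by (simp_all add: ABC N gens \<pi>.hom_nat_pow \<pi>.hom_int_pow)
  have BC: "B \<otimes>\<^bsub>P\<^esub> C = C \<otimes>\<^bsub>P\<^esub> B"
    using rel(4) cl by (simp add: P.m_assoc P.inv_solve_left')
  let ?NF = "normal_forms P A B C"
  note absorb = P.normal_forms_absorb[OF cl rel(1) N_pos BC rel(5,6)]
  have "z \<in> ?NF" if "z \<in> carrier P" for z
    using that unfolding P_def
  proof (rule presented_induct)
    show "\<one>\<^bsub>presented_group E\<^esub> \<in> normal_forms (presented_group E) A B C"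
      unfolding normal_forms_def using cl
      by (intro CollectI exI[of _ "0::int"]) (simp flip: P_def)
    fix x w assume w: "w \<in> normal_forms (presented_group E) A B C"
    note absorb = absorb[OF w[folded P_def]]
    show "presented_class E (free_gen x) \<otimes>\<^bsub>presented_group E\<^esub> w \<in> normal_forms (presented_group E) A B C"
      using absorb(4) absorb(1,2)[of 1] cl by (cases x) (simp_all flip: P_def pc_def ABC)
    show "inv\<^bsub>presented_group E\<^esub> presented_class E (free_gen x) \<otimes>\<^bsub>presented_group E\<^esub> w
        \<in> normal_forms (presented_group E) A B C"
      using absorb(3) absorb(1,2)[of "-1"] cl by (cases x) (simp_all add: P.int_pow_neg flip: P_def pc_def ABC)
  qed
  then have sub: "carrier P \<subseteq> ?NF" by blast
  have "p > 0" using prime_p by (rule prime_gt_0_nat)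
  note card = P.card_normal_forms[OF cl rel(1-3) N_pos this]
  have fin: "finite (carrier P)" using card(1) sub by (rule finite_subset[rotated])
  have card_P: "card (carrier P) \<le> card (carrier M)"
    using card_mono[OF card(1) sub] card(2) by (simp add: card_M)

  define h where "h x = (case x of GenA \<Rightarrow> inv\<^bsub>M\<^esub> (\<zero>, \<alpha>) | GenB \<Rightarrow> (s, \<one>) | GenC \<Rightarrow> (\<one>, \<one>))" for x
  have mem: "(\<zero>, \<alpha>) \<in> carrier M" "(s, \<one>) \<in> carrier M" "(\<one>, \<one>) \<in> carrier M"
    by (simp_all add: carrier_M)
  then have "range h \<subseteq> carrier M" by (auto simp: h_def split: abc.splits)
  then obtain f where f: "f \<in> hom ?F M" "\<And>x. f (free_gen x) = h x"
    using M.free_group_universal by blast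
  interpret f: group_hom ?F M f
    using f by (simp add: group_hom_def group_hom_axioms_def F.is_group group_M)
  have conj_M: "(\<zero>, \<alpha>) \<otimes>\<^bsub>M\<^esub> (k, \<one>) \<otimes>\<^bsub>M\<^esub> inv\<^bsub>M\<^esub> (\<zero>, \<alpha>) = (\<alpha> \<otimes> k, \<one>)" if "k \<in> carrier K" for k
  proof -
    have "(\<zero>, \<alpha>) \<otimes>\<^bsub>M\<^esub> (k, \<one>) = (\<alpha> \<otimes> k, \<one>) \<otimes>\<^bsub>M\<^esub> (\<zero>, \<alpha>)"
      using that by (simp add: mult_M)
    moreover have "(\<alpha> \<otimes> k, \<one>) \<in> carrier M" using that by (simp add: carrier_M)
    ultimately show ?thesis using mem by (simp add: M.m_assoc)
  qed
  have tr: "(k, \<one>) [^]\<^bsub>M\<^esub> p = \<one>\<^bsub>M\<^esub>" if "k \<in> carrier K" for k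
    using pow_M_translation[OF that, of "int p"] that by (simp add: int_pow_int one_M)
  have r1: "inv\<^bsub>M\<^esub> (\<zero>, \<alpha>) [^]\<^bsub>M\<^esub> N = \<one>\<^bsub>M\<^esub>"
    using mem alpha_pow_eq_one[of N] by (simp add: M.nat_pow_inv pow_M_rotation flip: one_M)
  have r4: "inv\<^bsub>M\<^esub> (s, \<one>) \<otimes>\<^bsub>M\<^esub> inv\<^bsub>M\<^esub> (\<one>, \<one>) \<otimes>\<^bsub>M\<^esub> (s, \<one>) \<otimes>\<^bsub>M\<^esub> (\<one>, \<one>) = \<one>\<^bsub>M\<^esub>"
  proof -
    have "(\<one>, \<one>) \<otimes>\<^bsub>M\<^esub> (s, \<one>) = (s, \<one>) \<otimes>\<^bsub>M\<^esub> (\<one>, \<one>)" by (simp add: mult_M a_comm)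
    then have "inv\<^bsub>M\<^esub> (\<one>, \<one>) \<otimes>\<^bsub>M\<^esub> ((s, \<one>) \<otimes>\<^bsub>M\<^esub> (\<one>, \<one>)) = (s, \<one>)"
      using M.inv_solve_left'[OF mem(2,3)] mem by simp
    then show ?thesis using mem by (simp add: M.m_assoc)
  qed
  have r5: "(\<zero>, \<alpha>) \<otimes>\<^bsub>M\<^esub> (s, \<one>) \<otimes>\<^bsub>M\<^esub> inv\<^bsub>M\<^esub> (\<zero>, \<alpha>)
      = (s, \<one>) [^]\<^bsub>M\<^esub> m \<otimes>\<^bsub>M\<^esub> (\<one>, \<one>) [^]\<^bsub>M\<^esub> (n * D)"
  proof -
    have "\<alpha> \<otimes> s = lin (n * D) m" using lin_mult[of m n 0 1] by (simp add: alpha_lin lin_0_1)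
    also have "\<dots> = emb m \<otimes> s \<oplus> emb (n * D)" by (simp add: lin_def a_comm)
    finally show ?thesis unfolding conj_M[OF s_closed] by (simp add: pow_M_translation mult_M)
  qed
  have r6: "(\<zero>, \<alpha>) \<otimes>\<^bsub>M\<^esub> (\<one>, \<one>) \<otimes>\<^bsub>M\<^esub> inv\<^bsub>M\<^esub> (\<zero>, \<alpha>)
      = (s, \<one>) [^]\<^bsub>M\<^esub> n \<otimes>\<^bsub>M\<^esub> (\<one>, \<one>) [^]\<^bsub>M\<^esub> m"
  proof -
    have "\<alpha> = emb n \<otimes> s \<oplus> emb m" by (simp add: alpha_lin lin_def a_comm)
    then show ?thesis unfolding conj_M[OF one_closed] by (simp add: pow_M_translation mult_M)
  qed
  have img: "f ?a = inv\<^bsub>M\<^esub> (\<zero>, \<alpha>)" "f ?b = (s, \<one>)" "f ?c = (\<one>, \<one>)"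
    by (simp_all add: f(2) h_def)
  have rel_M: "f u = f v" if "(u, v) \<in> E" for u v
    using that unfolding E_def
    by (elim insertE emptyE; simp only: prod.inject; elim conjE;
      simp add: gens img mem f.hom_nat_pow f.hom_int_pow tr r1 r4 r5 r6 flip: N)
  obtain g where g: "g \<in> hom P M" "\<And>u. u \<in> carrier ?F \<Longrightarrow> g (pc u) = f u"
    using presented_universal[OF group_M f(1) rel_M] unfolding P_def pc_def by blast
  interpret g: group_hom P M g using g by (simp add: group_hom_def group_hom_axioms_def P.is_group group_M)
  have gA: "g A = inv\<^bsub>M\<^esub> (\<zero>, \<alpha>)" and gB: "g B = (s, \<one>)" and gC: "g C = (\<one>, \<one>)"
    by (simp_all add: ABC g(2) gens f(2) h_def)
  have sur: "g ` carrier P = carrier M"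
  proof
    show "carrier M \<subseteq> g ` carrier P"
    proof
      fix z assume "z \<in> carrier M"
      then obtain k u where k: "k \<in> carrier K" and "u \<in> U" "z = (k, u)" by (auto simp: carrier_M)
      then obtain i :: nat where z: "z = (k, \<alpha> [^] i)" using U_powers by blast
      obtain x y where xy: "k = lin x y" using k by (rule linE)
      have "g (C [^]\<^bsub>P\<^esub> x \<otimes>\<^bsub>P\<^esub> B [^]\<^bsub>P\<^esub> y \<otimes>\<^bsub>P\<^esub> (inv\<^bsub>P\<^esub> A) [^]\<^bsub>P\<^esub> i)
          = (emb x \<otimes> \<one>, \<one>) \<otimes>\<^bsub>M\<^esub> (emb y \<otimes> s, \<one>) \<otimes>\<^bsub>M\<^esub> (\<zero>, \<alpha>) [^]\<^bsub>M\<^esub> i"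
        using cl mem by (simp add: g.hom_nat_pow g.hom_int_pow gA gB gC pow_M_translation)
      also have "\<dots> = z" by (simp add: z xy lin_def mult_M pow_M_rotation)
      finally show "z \<in> g ` carrier P" using cl by (metis P.int_pow_closed P.inv_closed P.m_closed P.nat_pow_closed imageI)
    qed
  qed auto
  have "card (g ` carrier P) = card (carrier P)"
    using card_P card_image_le[OF fin, of g] by (simp add: sur)
  then have "inj_on g (carrier P)" by (rule eq_card_imp_inj_on[OF fin])
  with sur have "g \<in> iso P M" using g(1) by (simp add: iso_def bij_betw_def)
  then show "G_group p q D m n \<cong> M" unfolding G P_def by (rule is_isoI)
qed

end

section \<open>Structure of the automorphism group\<close>

lemma (in group) cyclic_hom:
  assumes "a \<in> carrier G" "ord a = r" "r > 0"
  shows "(\<lambda>j::int. a [^] j) \<in> hom (integer_mod_group r) G"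
    and "inj_on (\<lambda>j::int. a [^] j) (carrier (integer_mod_group r))"
proof -
  have a: "a [^] r = \<one>" using assms pow_ord_eq_1 by auto
  show "(\<lambda>j::int. a [^] j) \<in> hom (integer_mod_group r) G"
    using assms(1) by (intro homI) (simp_all add: int_pow_mult flip: int_pow_mod[OF assms(1) a])
  show "inj_on (\<lambda>j::int. a [^] j) (carrier (integer_mod_group r))"
  proof (rule inj_onI)
    fix i j :: int assume "i \<in> carrier (integer_mod_group r)" "j \<in> carrier (integer_mod_group r)"
      and "a [^] i = a [^] j"
    then have "[i = j] (mod int r)" "0 \<le> i" "i < int r" "0 \<le> j" "j < int r"
      using assms by (simp_all add: int_pow_eq carrier_integer_mod_group cong_iff_dvd_diff dvd_diff_commute)
    then show "i = j" by (simp add: cong_def)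
  qed
qed

lemma (in quadratic_field) ord_primitive_root:
  assumes "\<sigma> \<in> carrier (mult_of K)" "generate (mult_of K) {\<sigma>} = carrier (mult_of K)"
  shows "group.ord (mult_of K) \<sigma> = p\<^sup>2 - 1" "p\<^sup>2 - 1 > 0"
proof -
  show "group.ord (mult_of K) \<sigma> = p\<^sup>2 - 1"
    using group.generate_pow_card[OF field_mult_group assms(1)] assms(2) finite_K card_K
    by (simp add: card_Diff_singleton)
  show "p\<^sup>2 - 1 > 0"
    using one_less_power[OF prime_gt_1_nat[OF prime_p], of 2] by simp
qed

context affine_group
begin

lemma phi_mult:
  assumes "t \<in> carrier K" "\<mu> \<in> carrier K" "\<mu> \<noteq> \<zero>" "t' \<in> carrier K" "\<mu>' \<in> carrier K" "\<mu>' \<noteq> \<zero>"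
  shows "phi t \<mu> e \<otimes>\<^bsub>AutoGroup M\<^esub> phi t' \<mu>' e' = phi (t \<oplus> \<mu> \<otimes> Fr e t') (\<mu> \<otimes> Fr e \<mu>') (e \<noteq> e')"
  using assms by (simp add: mult_AutoGroup[OF phi_auto phi_auto] phi_comp)

lemma Fr_nonzero: "z \<in> carrier K \<Longrightarrow> z \<noteq> \<zero> \<Longrightarrow> Fr e z \<noteq> \<zero>"
  using Fr_eq_iff[of z \<zero> e] by simp

text \<open>The conjugations by maps that fix the origin of \<open>K\<close>; they form the complement of the conjugations
  by translations.\<close>

definition semilinear :: "('a \<times> 'a \<Rightarrow> 'a \<times> 'a) set" where
  "semilinear = {phi \<zero> \<mu> e | \<mu> e. \<mu> \<in> carrier K \<and> \<mu> \<noteq> \<zero>}"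

lemma subgroup_semilinear: "subgroup semilinear (AutoGroup M)"
proof -
  interpret A: group "AutoGroup M" by (rule M.AutoGroup)
  show ?thesis
  proof (rule A.subgroupI)
    show "semilinear \<subseteq> carrier (AutoGroup M)" by (auto simp: semilinear_def phi_auto)
    have "phi \<zero> \<one> False \<in> semilinear" unfolding semilinear_def by (rule CollectI) (use one_not_zero in blast)
    then show "semilinear \<noteq> {}" by blast
    fix f assume "f \<in> semilinear"
    then obtain \<mu> e where f: "f = phi \<zero> \<mu> e" "\<mu> \<in> carrier K" "\<mu> \<noteq> \<zero>" by (auto simp: semilinear_def)
    {
      have inv: "inv \<mu> \<in> carrier K" "inv \<mu> \<otimes> \<mu> = \<one>" using f field_Units by auto
      then have nz: "inv \<mu> \<noteq> \<zero>" using f by auto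
      have "phi \<zero> (Fr e (inv \<mu>)) e \<otimes>\<^bsub>AutoGroup M\<^esub> f = \<one>\<^bsub>AutoGroup M\<^esub>"
        using f inv Fr_nonzero[OF inv(1) nz, of e]
        by (simp add: phi_mult one_AutoGroup phi_id flip: Fr_mult)
      then have "inv\<^bsub>AutoGroup M\<^esub> f = phi \<zero> (Fr e (inv \<mu>)) e"
        using f inv Fr_nonzero[OF inv(1) nz, of e] by (intro A.inv_equality) (simp_all add: phi_auto)
      then show "inv\<^bsub>AutoGroup M\<^esub> f \<in> semilinear"
        using inv Fr_nonzero[OF inv(1) nz, of e] by (auto simp: semilinear_def)
    }
    fix g assume "g \<in> semilinear"
    then obtain \<mu>' e' where "g = phi \<zero> \<mu>' e'" "\<mu>' \<in> carrier K" "\<mu>' \<noteq> \<zero>" by (auto simp: semilinear_def)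
    with f show "f \<otimes>\<^bsub>AutoGroup M\<^esub> g \<in> semilinear"
      using Fr_nonzero[of \<mu>' e] by (auto simp: phi_mult semilinear_def integral_iff)
  qed
qed

lemma hom_translations:
  "(\<lambda>(x, y). phi (lin x y) \<one> False) \<in> hom (integer_mod_group p \<times>\<times> integer_mod_group p) (AutoGroup M)"
proof (rule homI)
  fix v w :: "int \<times> int"
  obtain x y x' y' where vw: "v = (x, y)" "w = (x', y')" by (cases v, cases w)
  have "lin ((x + x') mod int p) ((y + y') mod int p) = lin x y \<oplus> lin x' y'"
    by (simp add: lin_add lin_eq_iff)
  then show "(\<lambda>(x, y). phi (lin x y) \<one> False) (v \<otimes>\<^bsub>integer_mod_group p \<times>\<times> integer_mod_group p\<^esub> w)
      = (\<lambda>(x, y). phi (lin x y) \<one> False) v \<otimes>\<^bsub>AutoGroup M\<^esub> (\<lambda>(x, y). phi (lin x y) \<one> False) w"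
    by (simp add: vw phi_mult Fr_def)
qed (auto simp: phi_auto)

lemma carrier_DirProd_p: "carrier (integer_mod_group p \<times>\<times> integer_mod_group p) = {0..<int p} \<times> {0..<int p}"
  using prime_gt_0_nat[OF prime_p] by (simp add: DirProd_def carrier_integer_mod_group)

lemma Aut_M_structure:
  assumes \<sigma>: "\<sigma> \<in> carrier (mult_of K)" and gen: "generate (mult_of K) {\<sigma>} = carrier (mult_of K)"
  shows "\<exists>\<psi> \<in> hom (integer_mod_group 2) (AutoGroup (integer_mod_group (p\<^sup>2 - 1))).
         \<exists>\<theta> \<in> hom (semidirect (integer_mod_group (p\<^sup>2 - 1)) (integer_mod_group 2) \<psi>)
                  (AutoGroup (integer_mod_group p \<times>\<times> integer_mod_group p)).
           AutoGroup M \<cong>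
             semidirect (integer_mod_group p \<times>\<times> integer_mod_group p)
               (semidirect (integer_mod_group (p\<^sup>2 - 1)) (integer_mod_group 2) \<psi>) \<theta>"
proof -
  interpret A: group "AutoGroup M" by (rule M.AutoGroup)
  interpret S: subgroup semilinear "AutoGroup M" by (rule subgroup_semilinear)
  interpret K: group "mult_of K" by (rule field_mult_group)
  let ?S = "AutoGroup M \<lparr>carrier := semilinear\<rparr>"
  let ?Z = "integer_mod_group (p\<^sup>2 - 1)"
  note ord = ord_primitive_root[OF assms(1,2)]
  note cyc = K.cyclic_hom[OF \<sigma> ord]
  define pw where "pw j = \<sigma> [^]\<^bsub>mult_of K\<^esub> (j::int)" for j
  have pw: "pw j \<in> carrier K" "pw j \<noteq> \<zero>" for j
    using K.int_pow_closed[OF \<sigma>, of j] by (simp_all add: pw_def)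
  have pw_sur: "\<exists>j\<in>carrier ?Z. \<mu> = pw j" if "\<mu> \<in> carrier K" "\<mu> \<noteq> \<zero>" for \<mu>
  proof -
    have "\<mu> \<in> generate (mult_of K) {\<sigma>}" using that gen by simp
    then obtain j :: int where "\<mu> = pw j" by (auto simp: K.generate_pow[OF \<sigma>] pw_def)
    moreover have "pw j = pw (j mod int (p\<^sup>2 - 1))"
      unfolding pw_def using K.int_pow_mod[OF \<sigma>] K.pow_ord_eq_1[OF \<sigma>] ord(1) by metis
    moreover have "j mod int r \<in> carrier (integer_mod_group r)" if "r > 0" for r
      using that by (simp add: carrier_integer_mod_group)
    from this[OF ord(2)] have "j mod int (p\<^sup>2 - 1) \<in> carrier ?Z" .
    ultimately show ?thesis by metis
  qed
  have Z2: "carrier (integer_mod_group 2) = {0, 1}" by (auto simp: carrier_integer_mod_group)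
  \<comment> \<open>The cyclic factor acts by \<open>x \<mapsto> \<sigma>\<^sup>j x\<close>, the factor of order two by the conjugation.\<close>
  define g1 where "g1 j = phi \<zero> (pw j) False" for j
  define g2 where "g2 j = phi \<zero> \<one> (j = 1)" for j :: int
  have phi_S: "phi \<zero> \<mu> e \<in> semilinear" if "\<mu> \<in> carrier K" "\<mu> \<noteq> \<zero>" for \<mu> e
    using that by (auto simp: semilinear_def)
  have g1: "g1 \<in> hom ?Z ?S"
  proof (rule homI)
    fix i j assume "i \<in> carrier ?Z" "j \<in> carrier ?Z"
    then have "pw (i \<otimes>\<^bsub>?Z\<^esub> j) = pw i \<otimes> pw j"
      using hom_mult[OF cyc(1)] by (simp add: pw_def)
    then show "g1 (i \<otimes>\<^bsub>?Z\<^esub> j) = g1 i \<otimes>\<^bsub>?S\<^esub> g1 j"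
      using pw by (simp add: g1_def phi_mult Fr_def)
  qed (simp add: g1_def phi_S pw)
  have g1_inj: "inj_on g1 (carrier ?Z)"
  proof (rule inj_onI)
    fix i j assume ij: "i \<in> carrier ?Z" "j \<in> carrier ?Z" "g1 i = g1 j"
    then have "pw i = pw j" using phi_eqD pw unfolding g1_def by blast
    then show "i = j" using inj_onD[OF cyc(2)] ij by (simp add: pw_def)
  qed
  have g2: "g2 \<in> hom (integer_mod_group 2) ?S" "inj_on g2 (carrier (integer_mod_group 2))"
    using phi_eqD[of \<zero> \<one> False \<zero> \<one> True]
    by (auto simp: Z2 g2_def phi_S phi_mult hom_def)
  have "group ?S" by (rule S.subgroup_is_group[OF A.is_group])
  then obtain \<psi> where \<psi>: "\<psi> \<in> hom (integer_mod_group 2) (AutoGroup ?Z)"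
    and iso1: "(\<lambda>(x, y). g1 x \<otimes>\<^bsub>?S\<^esub> g2 y) \<in> iso (semidirect ?Z (integer_mod_group 2) \<psi>) ?S"
  proof (rule semidirect_recognition[OF _ group_integer_mod_group group_integer_mod_group g1 g1_inj g2])
    fix x y assume xy: "x \<in> carrier ?Z" "y \<in> carrier (integer_mod_group 2)"
    obtain x' where x': "x' \<in> carrier ?Z" "Fr (y = 1) (pw x) = pw x'"
      using pw_sur[of "Fr (y = 1) (pw x)"] pw Fr_nonzero by auto
    then show "\<exists>x'\<in>carrier ?Z. g2 y \<otimes>\<^bsub>?S\<^esub> g1 x = g1 x' \<otimes>\<^bsub>?S\<^esub> g2 y"
      using pw by (intro bexI[of _ x']) (simp_all add: g1_def g2_def phi_mult)
    assume "g1 x = g2 y"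
    then have "pw x = pw 0" using phi_eqD[of \<zero> "pw x" False \<zero> \<one>] pw by (simp add: g1_def g2_def pw_def)
    then show "x = \<one>\<^bsub>?Z\<^esub>" using inj_onD[OF cyc(2)] xy by (simp add: pw_def)
  next
    fix z assume "z \<in> carrier ?S"
    then obtain \<mu> e where z: "z = phi \<zero> \<mu> e" "\<mu> \<in> carrier K" "\<mu> \<noteq> \<zero>" by (auto simp: semilinear_def)
    obtain x where x: "x \<in> carrier ?Z" "\<mu> = pw x" using pw_sur z by blast
    then have "z = g1 x \<otimes>\<^bsub>?S\<^esub> g2 (if e then 1 else 0)"
      using z by (simp add: g1_def g2_def phi_mult Fr_def)
    with x show "\<exists>x\<in>carrier ?Z. \<exists>y\<in>carrier (integer_mod_group 2). z = g1 x \<otimes>\<^bsub>?S\<^esub> g2 y"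
      by (intro bexI[of _ x] bexI[of _ "if e then 1 else 0"]) (auto simp: Z2)
  qed
  let ?H = "semidirect ?Z (integer_mod_group 2) \<psi>"
  let ?N = "integer_mod_group p \<times>\<times> integer_mod_group p"
  define f where "f = (\<lambda>(x, y). phi (lin x y) \<one> False)"
  define g where "g = (\<lambda>(x, y). g1 x \<otimes>\<^bsub>?S\<^esub> g2 y)"
  have f_hom: "f \<in> hom ?N (AutoGroup M)" unfolding f_def by (rule hom_translations)
  have N: "group ?N" by (simp add: DirProd_group)
  have f_sur: "\<exists>x\<in>carrier ?N. f x = phi t \<one> False" if "t \<in> carrier K" for t
  proof -
    have "t \<in> (\<lambda>(x, y). lin x y) ` carrier ?N"
      using that lin_bij unfolding carrier_DirProd_p bij_betw_def by simp
    then show ?thesis by (auto simp: f_def)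
  qed
  have f_inj: "inj_on f (carrier ?N)"
  proof (rule inj_onI)
    fix v w assume vw: "v \<in> carrier ?N" "w \<in> carrier ?N" "f v = f w"
    then have "case_prod lin v = case_prod lin w"
      by (auto simp: f_def split: prod.splits dest: phi_eqD)
    then show "v = w"
      using vw(1,2) unfolding carrier_DirProd_p by (rule inj_onD[OF bij_betw_imp_inj_on[OF lin_bij]])
  qed
  have g_S: "g ` carrier ?H = semilinear" and g_inj: "inj_on g (carrier ?H)"
    using iso1 by (auto simp: iso_def bij_betw_def g_def)
  have g_hom: "g \<in> hom ?H (AutoGroup M)"
    using iso1 S.subset by (auto simp: iso_def hom_def g_def)
  have H: "group ?H" by (rule group_semidirect[OF _ _ \<psi>]) simp_all
  obtain \<theta> where \<theta>: "\<theta> \<in> hom ?H (AutoGroup ?N)"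
    and iso2: "(\<lambda>(x, y). f x \<otimes>\<^bsub>AutoGroup M\<^esub> g y) \<in> iso (semidirect ?N ?H \<theta>) (AutoGroup M)"
  proof (rule semidirect_recognition[OF A.is_group N H f_hom f_inj g_hom g_inj])
    fix x y assume x: "x \<in> carrier ?N" and y: "y \<in> carrier ?H"
    obtain \<mu> e where gy: "g y = phi \<zero> \<mu> e" "\<mu> \<in> carrier K" "\<mu> \<noteq> \<zero>"
      using g_S y unfolding semilinear_def by blast
    obtain t where fx: "f x = phi t \<one> False" "t \<in> carrier K" by (cases x) (auto simp: f_def)
    obtain x' where x': "x' \<in> carrier ?N" "f x' = phi (\<mu> \<otimes> Fr e t) \<one> False"
      using f_sur[of "\<mu> \<otimes> Fr e t"] gy fx by auto
    then have "g y \<otimes>\<^bsub>AutoGroup M\<^esub> f x = f x' \<otimes>\<^bsub>AutoGroup M\<^esub> g y"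
      using gy fx by (simp add: phi_mult Fr_def[of False])
    with x' show "\<exists>x'\<in>carrier ?N. g y \<otimes>\<^bsub>AutoGroup M\<^esub> f x = f x' \<otimes>\<^bsub>AutoGroup M\<^esub> g y" by blast
    assume "f x = g y"
    then have "t = \<zero>" using phi_eqD fx gy by (metis one_closed zero_closed)
    then have "f x = \<one>\<^bsub>AutoGroup M\<^esub>" using fx by (simp add: one_AutoGroup phi_id)
    then show "x = \<one>\<^bsub>?N\<^esub>"
      using hom_one[OF f_hom N A.is_group] inj_onD[OF f_inj] x group.is_monoid[OF N]
      by (metis monoid.one_closed)
  next
    fix z assume "z \<in> carrier (AutoGroup M)"
    then obtain t \<mu> e where z: "t \<in> carrier K" "\<mu> \<in> carrier K" "\<mu> \<noteq> \<zero>" "z = phi t \<mu> e"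
      by (rule auto_is_phi)
    obtain x where x: "x \<in> carrier ?N" "f x = phi t \<one> False" using f_sur z by blast
    obtain y where y: "y \<in> carrier ?H" "g y = phi \<zero> \<mu> e" using phi_S[OF z(2,3), of e] g_S by (metis imageE)
    have "z = f x \<otimes>\<^bsub>AutoGroup M\<^esub> g y" using x y z by (simp add: phi_mult Fr_def[of False])
    with x y show "\<exists>x\<in>carrier ?N. \<exists>y\<in>carrier ?H. z = f x \<otimes>\<^bsub>AutoGroup M\<^esub> g y" by blast
  qed
  have "AutoGroup M \<cong> semidirect ?N ?H \<theta>"
    using group.iso_sym[OF group_semidirect[OF N H \<theta>] is_isoI[OF iso2]] .
  with \<psi> \<theta> show ?thesis by blast
qed

end

text \<open>With \<open>\<sigma>\<close> of order \<open>d N\<close>, the power \<open>\<sigma>\<^sup>j\<close> is an \<open>N\<close>-th root of unity just when \<open>d\<close>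
  divides \<open>j\<close>, that is, when \<open>\<sigma>\<^sup>j\<close> is a power of \<open>\<sigma>\<^sup>d\<close>.\<close>

lemma (in quadratic_field) primitive_root_affine_group:
  assumes \<sigma>: "\<sigma> \<in> carrier (mult_of K)" and gen: "generate (mult_of K) {\<sigma>} = carrier (mult_of K)"
    and N: "N dvd p\<^sup>2 - 1" "coprime N p" and n: "\<not> int p dvd n"
    and \<alpha>: "lin m n = \<sigma> [^] ((p\<^sup>2 - 1) div N)"
  shows "affine_group K p D s (lin m n) m n N"
proof
  interpret K: group "mult_of K" by (rule field_mult_group)
  note ord = ord_primitive_root[OF assms(1,2)]
  define d where "d = (p\<^sup>2 - 1) div N"
  have "d * N = p\<^sup>2 - 1" using N(1) by (simp add: d_def)
  moreover from this have "d \<noteq> 0" "N \<noteq> 0" using ord(2) by (metis less_irrefl mult_zero_left mult_zero_right)+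
  ultimately have d: "d * N = p\<^sup>2 - 1" "d > 0" and "N > 0" by simp_all
  have pow_one: "\<sigma> [^] i = \<one> \<longleftrightarrow> d * N dvd i" for i :: nat
    using K.pow_eq_id[OF \<sigma>, of i] by (simp add: ord(1) d nat_pow_mult_of)
  show "N > 0" by fact
  show "lin m n [^] i = \<one> \<longleftrightarrow> N dvd i" for i :: nat
  proof -
    have "lin m n [^] i = \<sigma> [^] (d * i)" using \<sigma> by (simp add: \<alpha> d_def nat_pow_pow)
    then show ?thesis using d(2) by (simp only: pow_one) simp
  qed
  show "\<exists>i::nat. u = lin m n [^] i" if u: "u \<in> carrier K" "u [^] N = \<one>" for u
  proof -
    have "u \<noteq> \<zero>" using u \<open>N > 0\<close> by (auto simp: nat_pow_zero)
    then have "u \<in> generate (mult_of K) {\<sigma>}" using u gen by simp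
    then obtain j :: nat where j: "u = \<sigma> [^] j"
      using K.generate_pow_on_finite_carrier[OF _ \<sigma>] finite_K by (auto simp: nat_pow_mult_of)
    then have "\<sigma> [^] (j * N) = \<one>" using u \<sigma> by (simp add: nat_pow_pow)
    then have "d dvd j" using \<open>N > 0\<close> by (simp add: pow_one)
    then obtain i where "j = d * i" by blast
    then have "u = lin m n [^] i" using \<sigma> by (simp add: j \<alpha> d_def nat_pow_pow)
    then show ?thesis by blast
  qed
qed (use N n in simp_all)

theorem mainTheorem14:
  fixes p q :: nat and D m n :: int
    and K :: "('k, 'e) ring_scheme" and \<sigma> s :: 'k
  assumes "prime p" and "prime q" and "p \<noteq> q" and "p * q \<noteq> 6"
    and "q\<^sup>2 dvd p + 1"
    and "D \<in> carrier (residue_ring (int p))" and "\<not> QuadRes (int p) D"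
    \<comment> \<open>\<open>K\<close> is \<open>GF(p\<^sup>2)\<close> and \<open>s\<close> is the square root of \<open>D\<close>;
      an element \<open>x\<close> of \<open>GF(p)\<close> sits in \<open>K\<close> as \<open>add_pow K x 1\<close>\<close>
    and "field K" and "card (carrier K) = p\<^sup>2"
    and "s \<in> carrier K" and "s [^]\<^bsub>K\<^esub> (2::nat) = add_pow K D \<one>\<^bsub>K\<^esub>"
    and "\<sigma> \<in> carrier (mult_of K)"
    and "generate (mult_of K) {\<sigma>} = carrier (mult_of K)"
    and "m \<in> carrier (residue_ring (int p))" and "n \<in> carrier (residue_ring (int p))"
    and "add_pow K m \<one>\<^bsub>K\<^esub> \<oplus>\<^bsub>K\<^esub> add_pow K n \<one>\<^bsub>K\<^esub> \<otimes>\<^bsub>K\<^esub> s = \<sigma> [^]\<^bsub>K\<^esub> ((p\<^sup>2 - 1) div q\<^sup>2)"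
    and "n \<noteq> 0"
  shows "\<exists>\<psi> \<in> hom (integer_mod_group 2) (AutoGroup (integer_mod_group (p\<^sup>2 - 1))).
         \<exists>\<theta> \<in> hom (semidirect (integer_mod_group (p\<^sup>2 - 1)) (integer_mod_group 2) \<psi>)
                  (AutoGroup (integer_mod_group p \<times>\<times> integer_mod_group p)).
           AutoGroup (G_group p q D m n) \<cong>
             semidirect (integer_mod_group p \<times>\<times> integer_mod_group p)
               (semidirect (integer_mod_group (p\<^sup>2 - 1)) (integer_mod_group 2) \<psi>) \<theta>"
proof -
  interpret field K by fact
  interpret quadratic_field K p D s
    using assms by unfold_locales (simp_all add: numeral_2_eq_2)
  have "p\<^sup>2 - 1 = (p + 1) * (p - 1)"
    by (cases p) (simp_all add: power2_eq_square)
  then have "q\<^sup>2 dvd p\<^sup>2 - 1" using assms(5) by (metis dvd_mult2)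
  moreover have "coprime (q\<^sup>2) p" using assms(1-3) by (simp add: primes_coprime)
  moreover have "\<not> int p dvd n"
    using assms(15,17) by (auto simp: residue_ring_def dest: zdvd_imp_le)
  moreover have "lin m n = \<sigma> [^]\<^bsub>K\<^esub> ((p\<^sup>2 - 1) div q\<^sup>2)"
    using assms(16) by (simp add: lin_def emb_def)
  ultimately interpret affine_group K p D s "lin m n" m n "q\<^sup>2"
    by (intro primitive_root_affine_group[OF assms(12,13)])
  obtain \<psi> \<theta> where \<psi>: "\<psi> \<in> hom (integer_mod_group 2) (AutoGroup (integer_mod_group (p\<^sup>2 - 1)))"
    and \<theta>: "\<theta> \<in> hom (semidirect (integer_mod_group (p\<^sup>2 - 1)) (integer_mod_group 2) \<psi>)
                  (AutoGroup (integer_mod_group p \<times>\<times> integer_mod_group p))"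
    and iso: "AutoGroup M \<cong> semidirect (integer_mod_group p \<times>\<times> integer_mod_group p)
               (semidirect (integer_mod_group (p\<^sup>2 - 1)) (integer_mod_group 2) \<psi>) \<theta>"
    using Aut_M_structure[OF assms(12,13)] by blast
  have "AutoGroup (G_group p q D m n) \<cong> AutoGroup M"
    using presented_group_iso[OF HOL.refl] by (intro AutoGroup_iso_cong group_M)
  then show ?thesis using iso_trans[OF _ iso] \<psi> \<theta> by blast
qed

end
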